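(* Let $N\in{}^*\mathbb{N}$ be infinite and $V\subseteq[1,N]$ a multiplicative cut. There is a well-defined map $\Upsilon=\Upsilon_{N,V}:\mathcal{H}_{1,N,V}\to\mathcal{H}_{1,N,V}$ given by $\Upsilon(\varphi_V(u))=\varphi_V(u^{-1})$, where $u^{-1}:=\lfloor N/u\rfloor$. Moreover, $\Upsilon$ is an invertible measure-preserving transformation (with respect to $\mathfrak{m}_{1,N,V}$) satisfying $\Upsilon^{-1}=\Upsilon$.
   Context: Work in a countably saturated nonstandard extension; ${}^*\mathbb{N}$ are the hypernaturals, $\mathrm{st}$ the standard part, intervals $[a,b]$ are sets of hypernaturals. A multiplicative cut is an infinite initial segment $V$ of ${}^*\mathbb{N}$ with $V\cdot V\subseteq V$. For $a\le b$ put $a\sim_V b$ iff $\lfloor b/a\rfloor\in V$ (an equivalence relation); $\varphi_V(a)=[a]^V$ is the class of $a$. $\nu_{1,N}$ is the Loeb measure on $[1,N]$ induced by $C\mapsto\mathrm{st}(\sum_{a\in C}\frac{1}{a\ln N})$ on internal $C$; $\mathcal{H}_{1,N,V}=\varphi_V([1,N])$ with $\mathfrak{m}_{1,N,V}(E)=\nu_{1,N}(\varphi_V^{-1}(E)\cap[1,N])$ for $E$ whose preimage is Loeb measurable. A map is invertible measure-preserving if it is measurable and measure-preserving and its inverse exists almost everywhere and is measure-preserving. *)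

theory Defs
  imports "HOL-Analysis.Analysis"
begin

text \<open>
  A nonstandard extension is taken axiomatically. The standard universe is any type \<open>'u\<close> that
  contains (injective copies of) the reals and the sets of reals, for example a level \<open>V\<^sub>n(\<real>)\<close> of the
  superstructure over the reals; \<open>'h\<close> is the nonstandard universe. Every finitary relation \<open>R\<close>
  on \<open>'u\<close>, given as a set of lists, has an extension \<open>\<^sup>*R\<close> on \<open>'h\<close>, and transfer holds for all
  first-order formulas in the language that names every such relation.
\<close>

datatype 'u fm =
    Rel "'u list set" "nat list"
  | Eq nat nat
  | Neg "'u fm"
  | Conj "'u fm" "'u fm"
  | Ex nat "'u fm"

primrec sat :: "('u list set \<Rightarrow> 'h list set) \<Rightarrow> 'u fm \<Rightarrow> (nat \<Rightarrow> 'h) \<Rightarrow> bool" where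
  "sat I (Rel R vs) e \<longleftrightarrow> map e vs \<in> I R"
| "sat I (Eq i j) e \<longleftrightarrow> e i = e j"
| "sat I (Neg f) e \<longleftrightarrow> \<not> sat I f e"
| "sat I (Conj f g) e \<longleftrightarrow> sat I f e \<and> sat I g e"
| "sat I (Ex i f) e \<longleftrightarrow> (\<exists>x. sat I f (e(i := x)))"

record ('u, 'h) extension =
  real_in :: "real \<Rightarrow> 'u"
  set_in :: "real set \<Rightarrow> 'u"
  star :: "'u \<Rightarrow> 'h"
  star_rel :: "'u list set \<Rightarrow> 'h list set"

text \<open>
  Sections \<open>{x. (x, p\<^sub>1, \<dots>, p\<^sub>k) \<in> \<^sup>*R}\<close> of extended relations are internal. Every internal set of
  hyperreals is such a section: \<open>R\<close> is the membership relation and the set itself the parameter.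
\<close>

definition internal :: "('u, 'h, 'z) extension_scheme \<Rightarrow> 'h set \<Rightarrow> bool" where
  "internal X A \<longleftrightarrow> (\<exists>R ps. A = {x. x # ps \<in> star_rel X R})"

definition nonstandard_extension :: "('u, 'h, 'z) extension_scheme \<Rightarrow> bool" where
  "nonstandard_extension X \<longleftrightarrow>
     inj (real_in X) \<and> inj (set_in X) \<and>
     (\<forall>f e. sat (\<lambda>R. R) f e \<longleftrightarrow> sat (star_rel X) f (star X \<circ> e))"

definition countably_saturated :: "('u, 'h, 'z) extension_scheme \<Rightarrow> bool" where
  "countably_saturated X \<longleftrightarrow>
     (\<forall>A :: nat \<Rightarrow> 'h set. (\<forall>n. internal X (A n)) \<and> (\<forall>n. (\<Inter>i\<le>n. A i) \<noteq> {})
        \<longrightarrow> (\<Inter>i. A i) \<noteq> {})"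

definition hreal :: "('u, 'h, 'z) extension_scheme \<Rightarrow> real \<Rightarrow> 'h" where
  "hreal X r = star X (real_in X r)"

definition hle :: "('u, 'h, 'z) extension_scheme \<Rightarrow> 'h \<Rightarrow> 'h \<Rightarrow> bool" where
  "hle X x y \<longleftrightarrow> [x, y] \<in> star_rel X {[real_in X a, real_in X b] | a b. a \<le> b}"

text \<open>The extension of a binary function on the reals, via its graph.\<close>

definition hfun2 :: "('u, 'h, 'z) extension_scheme \<Rightarrow> (real \<Rightarrow> real \<Rightarrow> real) \<Rightarrow> 'h \<Rightarrow> 'h \<Rightarrow> 'h" where
  "hfun2 X f x y =
     (THE z. [x, y, z] \<in> star_rel X {[real_in X a, real_in X b, real_in X (f a b)] | a b. True})"

definition hmult :: "('u, 'h, 'z) extension_scheme \<Rightarrow> 'h \<Rightarrow> 'h \<Rightarrow> 'h" where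
  "hmult X = hfun2 X (\<lambda>a b. a * b)"

definition hquot :: "('u, 'h, 'z) extension_scheme \<Rightarrow> 'h \<Rightarrow> 'h \<Rightarrow> 'h" where
  "hquot X = hfun2 X (\<lambda>a b. of_int \<lfloor>a / b\<rfloor>)"

definition standard_part :: "('u, 'h, 'z) extension_scheme \<Rightarrow> 'h \<Rightarrow> real" where
  "standard_part X x =
     (THE r. \<forall>\<epsilon>>0. [x] \<in> star_rel X {[real_in X y] | y. \<bar>y - r\<bar> < \<epsilon>})"

text \<open>The natural numbers start at 1, so that cuts are subsets of \<open>[1, N]\<close>.\<close>

definition hypnat :: "('u, 'h, 'z) extension_scheme \<Rightarrow> 'h set" where
  "hypnat X = {x. [x] \<in> star_rel X {[real_in X (real n)] | n. n \<ge> 1}}"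

definition infinite_hypnat :: "('u, 'h, 'z) extension_scheme \<Rightarrow> 'h \<Rightarrow> bool" where
  "infinite_hypnat X N \<longleftrightarrow> N \<in> hypnat X \<and> (\<forall>n::nat. hle X (hreal X (real n)) N)"

definition hinterval :: "('u, 'h, 'z) extension_scheme \<Rightarrow> 'h \<Rightarrow> 'h \<Rightarrow> 'h set" where
  "hinterval X a b = {x \<in> hypnat X. hle X a x \<and> hle X x b}"

definition multiplicative_cut :: "('u, 'h, 'z) extension_scheme \<Rightarrow> 'h set \<Rightarrow> bool" where
  "multiplicative_cut X V \<longleftrightarrow>
     V \<subseteq> hypnat X \<and> infinite V \<and>
     (\<forall>x\<in>V. \<forall>y\<in>hypnat X. hle X y x \<longrightarrow> y \<in> V) \<and>
     (\<forall>x\<in>V. \<forall>y\<in>V. hmult X x y \<in> V)"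

definition cut_equiv :: "('u, 'h, 'z) extension_scheme \<Rightarrow> 'h set \<Rightarrow> 'h \<Rightarrow> 'h \<Rightarrow> bool" where
  "cut_equiv X V a b \<longleftrightarrow> (if hle X a b then hquot X b a \<in> V else hquot X a b \<in> V)"

definition cut_class :: "('u, 'h, 'z) extension_scheme \<Rightarrow> 'h set \<Rightarrow> 'h \<Rightarrow> 'h set" where
  "cut_class X V a = {b \<in> hypnat X. cut_equiv X V a b}"

text \<open>
  Internal sets of hyperreals are the elements \<open>c\<close> of the extension of the power set of the reals,
  viewed as sets through the extension of the membership relation.
\<close>

definition elems :: "('u, 'h, 'z) extension_scheme \<Rightarrow> 'h \<Rightarrow> 'h set" where
  "elems X c = {x. [x, c] \<in> star_rel X {[real_in X a, set_in X A] | a A. a \<in> A}}"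

definition internal_subsets :: "('u, 'h, 'z) extension_scheme \<Rightarrow> 'h set \<Rightarrow> 'h set" where
  "internal_subsets X S = {c. [c] \<in> star_rel X {[set_in X A] | A. True} \<and> elems X c \<subseteq> S}"

text \<open>The hyperfinite sum of \<open>1 / (a ln N)\<close> over \<open>a\<close> in the hyperfinite internal set \<open>c\<close>.\<close>

definition log_sum :: "('u, 'h, 'z) extension_scheme \<Rightarrow> 'h \<Rightarrow> 'h \<Rightarrow> 'h" where
  "log_sum X N c =
     (THE z. [c, N, z] \<in> star_rel X
        {[set_in X A, real_in X n, real_in X (\<Sum>a\<in>A. 1 / (a * ln n))] | A n. finite A})"

definition loeb :: "('u, 'h, 'z) extension_scheme \<Rightarrow> 'h \<Rightarrow> 'h measure" where
  "loeb X N =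
     (let S = hinterval X (hreal X 1) N in
      completion (extend_measure S (internal_subsets X S) (elems X)
        (\<lambda>c. ennreal (standard_part X (log_sum X N c)))))"

definition cut_space :: "('u, 'h, 'z) extension_scheme \<Rightarrow> 'h \<Rightarrow> 'h set \<Rightarrow> 'h set set" where
  "cut_space X N V = cut_class X V ` hinterval X (hreal X 1) N"

definition cut_measure :: "('u, 'h, 'z) extension_scheme \<Rightarrow> 'h \<Rightarrow> 'h set \<Rightarrow> 'h set measure" where
  "cut_measure X N V =
     (let S = hinterval X (hreal X 1) N in
      measure_of (cut_space X N V)
        {E. E \<subseteq> cut_space X N V \<and> cut_class X V -` E \<inter> S \<in> sets (loeb X N)}
        (\<lambda>E. emeasure (loeb X N) (cut_class X V -` E \<inter> S)))"

definition measure_preserving_map :: "'a measure \<Rightarrow> ('a \<Rightarrow> 'a) \<Rightarrow> bool" where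
  "measure_preserving_map M T \<longleftrightarrow>
     T \<in> measurable M M \<and> (\<forall>A\<in>sets M. emeasure M (T -` A \<inter> space M) = emeasure M A)"

definition invertible_measure_preserving :: "'a measure \<Rightarrow> ('a \<Rightarrow> 'a) \<Rightarrow> bool" where
  "invertible_measure_preserving M T \<longleftrightarrow>
     measure_preserving_map M T \<and>
     (\<exists>S. measure_preserving_map M S \<and> (AE x in M. S (T x) = x) \<and> (AE x in M. T (S x) = x))"

end

theory Submission
  imports Defs
begin

text \<open>
  Write \<open>\<sigma> u = \<lfloor>N / u\<rfloor>\<close>. Up to bounded factors \<open>\<sigma>\<close> inverts ratios and is an involution, and a
  multiplicative cut absorbs bounded factors; so \<open>\<sigma>\<close> acts on the classes as an involution.

  On \<open>[1, N]\<close> itself \<open>\<sigma>\<close> does not preserve the measure: it collapses the upper half onto \<open>[1, \<surd>N]\<close>.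
  But the fibre of \<open>\<sigma>\<close> over \<open>a \<le> \<surd>N\<close> is an interval whose harmonic sum is \<open>1 / a\<close> up to an error of
  total size \<open>O(1)\<close>, which is infinitesimal after division by \<open>ln N\<close>. Hence every internal \<open>C\<close> is
  matched by an internal \<open>C'\<close> of at least the same Loeb measure, obtained from \<open>C\<close> by taking
  preimages below \<open>\<surd>N\<close> and images above. If \<open>C\<close> lies in a union \<open>B\<close> of classes, then \<open>C'\<close> lies in
  \<open>\<sigma>\<inverse> B\<close>. By saturation Loeb measurable sets are approximated from inside by internal sets, so the
  inner measures of \<open>\<sigma>\<inverse> B\<close> and of its complement are at least those of \<open>B\<close> and its complement, and
  the finiteness of the measure forces equality.
\<close>

section \<open>Harmonic sums over the fibres of division\<close>

text \<open>For \<open>1 \<le> u\<close>, both \<open>a \<le> m div u\<close> and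
  \<open>u \<le> m div a\<close> say that \<open>a * u \<le> m\<close>; two such thresholds, at
  \<open>a\<close> and at \<open>a + 1\<close>, cut out the fibre.\<close>

lemma fibre_div:
  fixes m a :: nat
  assumes "1 \<le> a"
  shows "{u \<in> {1..m}. m div u = a} = {m div (a + 1)<..m div a}"
proof -
  have "m div u = a \<longleftrightarrow> m div (a + 1) < u \<and> u \<le> m div a" if "1 \<le> u" for u
  proof -
    have "m div u = a \<longleftrightarrow> a \<le> m div u \<and> m div u < a + 1" by auto
    moreover have "a \<le> m div u \<longleftrightarrow> u \<le> m div a"
      using that assms by (simp add: less_eq_div_iff_mult_less_eq mult.commute)
    moreover have "m div u < a + 1 \<longleftrightarrow> m div (a + 1) < u"
      using that assms by (simp add: div_less_iff_less_mult mult.commute del: mult_Suc mult_Suc_right)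
    ultimately show ?thesis by blast
  qed
  then have "u \<in> {1..m} \<and> m div u = a \<longleftrightarrow> u \<in> {m div (a + 1)<..m div a}" for u
    using le_trans[OF _ div_le_dividend[of m a], of u] by (cases "1 \<le> u") auto
  then show ?thesis by blast
qed

text \<open>The fibre has \<open>m / (a * (a + 1))\<close> elements up to an error of 1 from
  rounding the endpoints, and on it \<open>1 / u\<close> lies between \<open>a / m\<close> and
  \<open>(a + 1) / m\<close>. Multiplying the bounds gives the two error terms.\<close>

lemma sum_inverse_fibre_div:
  fixes m a :: nat
  assumes "1 \<le> a" "1 \<le> m"
  defines "F \<equiv> {u \<in> {1..m}. m div u = a}"
  shows "1 / real a - (1 / (real a * (real a + 1)) + real a / real m) \<le> (\<Sum>u\<in>F. 1 / real u)" (is ?lower)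
    and "(\<Sum>u\<in>F. 1 / real u) \<le> 1 / real a + (real a + 1) / real m" (is ?upper)
proof -
  let ?p = "m div (a + 1)" and ?q = "m div a"
  have F: "F = {?p<..?q}" unfolding F_def using fibre_div assms(1) by simp
  have pq: "?p \<le> ?q" using assms(1) by (intro div_le_mono2) auto
  have card: "real (card F) = real ?q - real ?p" using pq by (simp add: F)
  have a: "real a > 0" and m: "real m > 0" using assms by auto
  have q: "real ?q \<le> m / a" by (rule of_nat_div_le_of_nat)
  have q': "m / a - 1 \<le> real ?q"
    using floor_divide_of_nat_eq[of m a, where ?'a = real] by linarith
  have p: "real ?p \<le> m / (real a + 1)" 
    using of_nat_div_le_of_nat[of m "a+1", where ?'a = real] by (simp add: add.commute)
  have p': "m / (real a + 1) \<le> real ?p + 1"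
    using floor_divide_of_nat_eq[of m "a+1", where ?'a = real] by (simp add: add.commute) linarith
  have diff: "m / a - m / (real a + 1) = m / (real a * (real a + 1))"
    using a by (simp add: field_simps)
  have "1 / real a - (1 / (real a * (real a + 1)) + real a / real m)
      = (m / a - m / (real a + 1) - 1) * (a / m)"
    unfolding diff using a m by (simp add: divide_simps) (simp add: algebra_simps)
  also have "\<dots> \<le> real (card F) * (a / m)"
    using card p q' by (intro mult_right_mono) auto
  also have "\<dots> = (\<Sum>u\<in>F. a / m)" by simp
  also have "\<dots> \<le> (\<Sum>u\<in>F. 1 / real u)"
  proof (rule sum_mono)
    fix u assume "u \<in> F"
    then have "0 < real u" "real u \<le> real ?q" by (auto simp: F)
    then have "real u \<le> m / a" using q by linarith
    then show "a / m \<le> 1 / real u" using a m \<open>0 < real u\<close> by (simp add: field_simps)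
  qed
  finally show ?lower .
  have "(\<Sum>u\<in>F. 1 / real u) \<le> (\<Sum>u\<in>F. (real a + 1) / m)"
  proof (rule sum_mono)
    fix u assume "u \<in> F"
    then have "0 < real u" "real ?p + 1 \<le> real u" by (auto simp: F)
    then have "m / (real a + 1) \<le> real u" using p' by linarith
    then show "1 / real u \<le> (real a + 1) / m" using a m \<open>0 < real u\<close> by (simp add: field_simps)
  qed
  also have "\<dots> = real (card F) * ((real a + 1) / m)" by simp
  also have "\<dots> \<le> (m / a - m / (real a + 1) + 1) * ((real a + 1) / m)"
    using card q p' a m by (intro mult_right_mono) auto
  also have "\<dots> = 1 / real a + (real a + 1) / real m"
    unfolding diff using a m by (simp add: divide_simps)
  finally show ?upper .
qed

lemma sum_telescope_inverse: "(\<Sum>a=1..k. 1 / (real a * (real a + 1))) \<le> 1"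
proof -
  have "(\<Sum>a=1..k. 1 / (real a * (real a + 1))) = 1 - 1 / (real k + 1)"
  proof (induction k)
    case (Suc k)
    have "1 / ((real k + 1) * (real k + 2)) = 1 / (real k + 1) - 1 / (real k + 2)"
      by (simp add: field_simps)
    with Suc show ?case by (simp add: add.commute)
  qed simp
  then show ?thesis by simp
qed

text \<open>With \<open>k\<close> the integer square root of \<open>m\<close>, at most
  \<open>k\<close> indices occur, so the terms of size at most \<open>(k + 1) / m\<close> add up to
  a bounded quantity because \<open>k * k \<le> m\<close>; the remaining series telescopes.\<close>

lemma sum_fibre_errors:
  fixes m :: nat
  assumes "1 \<le> m" "B \<subseteq> {a. 1 \<le> a \<and> a * a \<le> m}"
  shows "(\<Sum>a\<in>B. 1 / (real a * (real a + 1)) + real a / real m) \<le> 2" (is ?A)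
    and "(\<Sum>a\<in>B. (real a + 1) / real m) \<le> 2" (is ?B)
proof -
  define k where "k = Max {a. a * a \<le> m}"
  have fin: "finite {a. a * a \<le> m}"
    by (rule finite_subset[of _ "{..m}"]) (auto intro: le_trans[OF le_square])
  have k: "k * k \<le> m" using Max_in[OF fin] unfolding k_def by (metis empty_iff mem_Collect_eq mult_zero_left zero_le)
  have B: "B \<subseteq> {1..k}" using Max_ge[OF fin] assms(2) unfolding k_def by auto
  have k': "real k * real k \<le> real m" using k by (metis of_nat_le_iff of_nat_mult)
  have m: "real m > 0" using assms by simp
  have "real k \<le> real k * real k" using le_square[of k] by (metis of_nat_le_iff of_nat_mult)
  then have k2: "real k * (real k + 1) \<le> 2 * real m" using k' by (simp add: algebra_simps)
  have "(\<Sum>a\<in>B. 1 / (real a * (real a + 1)) + real a / real m)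
      \<le> (\<Sum>a=1..k. 1 / (real a * (real a + 1)) + real a / real m)"
    using B by (intro sum_mono2) auto
  also have "\<dots> = (\<Sum>a=1..k. 1 / (real a * (real a + 1))) + (\<Sum>a=1..k. real a / real m)"
    by (rule sum.distrib)
  also have "\<dots> \<le> 1 + (\<Sum>a=1..k. real k / real m)"
    using sum_telescope_inverse m by (intro add_mono sum_mono divide_right_mono) auto
  also have "\<dots> = 1 + real k * real k / m" by simp
  also have "\<dots> \<le> 2" using k' m by (simp add: field_simps)
  finally show ?A .
  have "(\<Sum>a\<in>B. (real a + 1) / real m) \<le> (\<Sum>a=1..k. (real a + 1) / real m)"
    using B by (intro sum_mono2) auto
  also have "\<dots> \<le> (\<Sum>a=1..k. (real k + 1) / real m)"
    using m by (intro sum_mono divide_right_mono) auto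
  also have "\<dots> = real k * (real k + 1) / m" by simp
  also have "\<dots> \<le> 2" using k2 m by (simp add: field_simps)
  finally show ?B .
qed

text \<open>Elements up to the square root of \<open>m\<close> are replaced by their whole fibres
  (\<open>B1\<close>), larger ones by their quotients (\<open>B2\<close>). Thus the fibre estimates
  are used only over \<open>a\<close> with \<open>a * a \<le> m\<close>, where the total error is at
  most 2 for each half.\<close>

lemma harmonic_sum_reflection:
  fixes m :: nat
  assumes m: "1 \<le> m" and A: "A \<subseteq> {1..m}"
  obtains A' where "A' \<subseteq> {1..m}"
    and "\<And>x. x \<in> A' \<Longrightarrow> \<exists>u\<in>A. x = m div u \<or> u = m div x"
    and "(\<Sum>a\<in>A. 1 / real a) \<le> (\<Sum>a\<in>A'. 1 / real a) + 4"
proof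
  define F where "F a = {u \<in> {1..m}. m div u = a}" for a
  define A1 where "A1 = {a \<in> A. a * a \<le> m}"
  define A2 where "A2 = {a \<in> A. m < a * a}"
  define B1 where "B1 = {u \<in> {1..m}. m div u \<in> A1}"
  define B2 where "B2 = (\<lambda>u. m div u) ` A2"
  have finA: "finite A" using A finite_subset by blast
  have fin: "finite A1" "finite A2" "finite B1" "finite B2" "\<And>a. finite (F a)"
    using finA by (auto simp: A1_def A2_def B1_def B2_def F_def)
  \<comment> \<open>The quotient of an element above the square root lies at or below it, so
    \<open>sum_fibre_errors\<close> applies to \<open>B2\<close>.\<close>
  have B2: "1 \<le> a \<and> a * a \<le> m" if "a \<in> B2" for a
  proof -
    obtain u where u: "u \<in> A" "m < u * u" "a = m div u" using \<open>a \<in> B2\<close> by (auto simp: B2_def A2_def)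
    have "u \<in> {1..m}" using u A by auto
    then have "1 \<le> a" using u by (simp add: Suc_le_eq div_greater_zero_iff)
    have au: "a * u \<le> m" using u by simp
    then have "a < u" using u(2) by (metis le_less_trans mult_less_cancel2)
    then show ?thesis using au \<open>1 \<le> a\<close> by (meson le_trans less_imp_le mult_le_mono2)
  qed
  show sub: "B1 \<union> B2 \<subseteq> {1..m}"
    using A by (auto simp: B1_def B2_def A2_def Suc_le_eq div_greater_zero_iff)
  show "\<exists>u\<in>A. x = m div u \<or> u = m div x" if "x \<in> B1 \<union> B2" for x
    using that by (auto simp: B1_def B2_def A1_def A2_def)
  \<comment> \<open>Dividing twice never decreases \<open>u\<close>: for \<open>u\<close> above the
    square root, \<open>m div (m div u)\<close> is still above it and hence not in
    \<open>A1\<close>.\<close>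
  have disj: "B1 \<inter> B2 = {}"
  proof (rule ccontr)
    assume "B1 \<inter> B2 \<noteq> {}"
    then obtain u where u: "u \<in> A" "m < u * u" "m div u \<in> B1" by (auto simp: B2_def A2_def)
    define a where "a = m div (m div u)"
    have "a * a \<le> m" "0 < m div u" using u(3) by (auto simp: B1_def A1_def a_def)
    then have "u \<le> a" unfolding a_def by (simp add: less_eq_div_iff_mult_less_eq)
    then have "u * u \<le> a * a" by (rule mult_le_mono) fact
    with u(2) \<open>a * a \<le> m\<close> show False by simp
  qed
  have A1: "(\<Sum>a\<in>A1. 1 / real a) \<le> (\<Sum>a\<in>B1. 1 / real a) + 2"
  proof -
    have "(\<Sum>a\<in>A1. 1 / real a)
        \<le> (\<Sum>a\<in>A1. (\<Sum>u\<in>F a. 1 / real u) + (1 / (real a * (real a + 1)) + real a / real m))"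
    proof (rule sum_mono)
      fix a assume "a \<in> A1"
      then have "1 \<le> a" using A by (auto simp: A1_def)
      from sum_inverse_fibre_div(1)[OF this m]
      show "1 / real a \<le> (\<Sum>u\<in>F a. 1 / real u) + (1 / (real a * (real a + 1)) + real a / real m)"
        by (simp add: F_def)
    qed
    also have "\<dots> = (\<Sum>a\<in>A1. (\<Sum>u\<in>F a. 1 / real u))
        + (\<Sum>a\<in>A1. 1 / (real a * (real a + 1)) + real a / real m)"
      by (rule sum.distrib)
    also have "(\<Sum>a\<in>A1. (\<Sum>u\<in>F a. 1 / real u)) = (\<Sum>u\<in>(\<Union>a\<in>A1. F a). 1 / real u)"
      using fin by (intro sum.UNION_disjoint[symmetric]) (auto simp: F_def)
    also have "(\<Union>a\<in>A1. F a) = B1" by (auto simp: F_def B1_def)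
    also have "(\<Sum>a\<in>A1. 1 / (real a * (real a + 1)) + real a / real m) \<le> 2"
      using A by (intro sum_fibre_errors m) (auto simp: A1_def)
    finally show ?thesis by simp
  qed
  have A2: "(\<Sum>a\<in>A2. 1 / real a) \<le> (\<Sum>a\<in>B2. 1 / real a) + 2"
  proof -
    \<comment> \<open>Enlarging \<open>A2\<close> to the full fibres over \<open>B2\<close> only
      increases the sum and makes the upper fibre bound available.\<close>
    have "(\<Sum>a\<in>A2. 1 / real a) \<le> (\<Sum>u\<in>(\<Union>a\<in>B2. F a). 1 / real u)"
    proof (rule sum_mono2)
      show "A2 \<subseteq> (\<Union>a\<in>B2. F a)"
        using A unfolding A2_def B2_def F_def by blast
    qed (use fin in auto)
    also have "\<dots> = (\<Sum>a\<in>B2. (\<Sum>u\<in>F a. 1 / real u))"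
      using fin by (intro sum.UNION_disjoint) (auto simp: F_def)
    also have "\<dots> \<le> (\<Sum>a\<in>B2. 1 / real a + (real a + 1) / real m)"
      unfolding F_def using B2 by (intro sum_mono sum_inverse_fibre_div m) auto
    also have "\<dots> = (\<Sum>a\<in>B2. 1 / real a) + (\<Sum>a\<in>B2. (real a + 1) / real m)"
      by (rule sum.distrib)
    also have "(\<Sum>a\<in>B2. (real a + 1) / real m) \<le> 2"
      using B2 by (intro sum_fibre_errors m) auto
    finally show ?thesis by simp
  qed
  have "A = A1 \<union> A2" "A1 \<inter> A2 = {}" by (auto simp: A1_def A2_def)
  then have "(\<Sum>a\<in>A. 1 / real a) = (\<Sum>a\<in>A1. 1 / real a) + (\<Sum>a\<in>A2. 1 / real a)"
    using fin by (simp add: sum.union_disjoint)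
  moreover have "(\<Sum>a\<in>B1 \<union> B2. 1 / real a) = (\<Sum>a\<in>B1. 1 / real a) + (\<Sum>a\<in>B2. 1 / real a)"
    using fin disj by (simp add: sum.union_disjoint)
  ultimately show "(\<Sum>a\<in>A. 1 / real a) \<le> (\<Sum>a\<in>B1 \<union> B2. 1 / real a) + 4"
    using A1 A2 by simp
qed

section \<open>Approximation by an algebra of sets\<close>

text \<open>The assumption \<open>outer\<close> isolates what saturation contributes: an increasing
  union of internal sets is covered by an internal set of nearly the same measure. The rest of the
  approximation argument is pure measure theory.\<close>

locale regular_finite_measure = finite_measure M for M :: "'a measure" +
  fixes \<A> :: "'a set set"
  assumes algebra_A: "algebra (space M) \<A>"
    and sets_A: "sets M = sigma_sets (space M) \<A>"
    and outer: "\<And>F \<epsilon>. range F \<subseteq> \<A> \<Longrightarrow> incseq F \<Longrightarrow> 0 < (\<epsilon>::real) \<Longrightarrow>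
      \<exists>D\<in>\<A>. (\<Union>n. F n) \<subseteq> D \<and> measure M D \<le> measure M (\<Union>n. F n) + \<epsilon>"
begin

interpretation \<A>: algebra "space M" \<A> by (rule algebra_A)

lemma A_sets: "C \<in> \<A> \<Longrightarrow> C \<in> sets M"
  unfolding sets_A by (rule sigma_sets.Basic)

text \<open>Induction over the generation of the sigma-algebra. Asking for inner and outer sets
  together makes complements immediate, since they swap the two. For unions, \<open>outer\<close>
  supplies the outer set and a finite stage the inner one.\<close>

lemma sandwich:
  assumes "B \<in> sets M" "0 < (\<epsilon>::real)"
  shows "\<exists>C\<in>\<A>. \<exists>D\<in>\<A>. C \<subseteq> B \<and> B \<subseteq> D \<and> measure M (D - C) \<le> \<epsilon>"
  using assms unfolding sets_A
proof (induction B arbitrary: \<epsilon>)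
  case (Basic B)
  then show ?case by (intro bexI[of _ B]) auto
next
  case Empty
  then show ?case by (intro bexI[of _ "{}"]) auto
next
  case (Compl B)
  then obtain C D where CD: "C \<in> \<A>" "D \<in> \<A>" "C \<subseteq> B" "B \<subseteq> D" "measure M (D - C) \<le> \<epsilon>"
    by meson
  have "(space M - C) - (space M - D) = D - C"
    using CD \<A>.sets_into_space by auto
  then show ?case
    using CD by (intro bexI[of _ "space M - D"] bexI[of _ "space M - C"] conjI) auto
next
  case (Union B)
  \<comment> \<open>These gaps sum to \<open>\<epsilon> / 4\<close>; two further quarters pay for
    the outer set \<open>E\<close> and for truncating the union of the \<open>C i\<close>.\<close>
  have "\<exists>C\<in>\<A>. \<exists>D\<in>\<A>. C \<subseteq> B i \<and> B i \<subseteq> D \<and> measure M (D - C) \<le> \<epsilon> / 4 * (1 / 2) ^ Suc i" for i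
    using Union.IH[of "\<epsilon> / 4 * (1 / 2) ^ Suc i" i] Union.prems by simp
  then obtain C D where CD: "\<And>i. C i \<in> \<A>" "\<And>i. D i \<in> \<A>" "\<And>i. C i \<subseteq> B i" "\<And>i. B i \<subseteq> D i"
      "\<And>i. measure M (D i - C i) \<le> \<epsilon> / 4 * (1 / 2) ^ Suc i"
    by metis
  define C' where "C' n = (\<Union>i\<le>n. C i)" for n
  define D' where "D' n = (\<Union>i\<le>n. D i)" for n
  have C': "range C' \<subseteq> \<A>" and D': "range D' \<subseteq> \<A>" using CD by (auto simp: C'_def D'_def)
  have inc: "incseq C'" "incseq D'"
    unfolding incseq_def C'_def D'_def by (auto intro: order_trans)
  have UN: "(\<Union>n. C' n) = (\<Union>n. C n)" "(\<Union>n. D' n) = (\<Union>n. D n)" by (auto simp: C'_def D'_def)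
  have [measurable]: "\<And>i. C i \<in> sets M" "\<And>i. D i \<in> sets M" "\<And>i. C' i \<in> sets M"
    using CD(1,2) C' A_sets by blast+
  obtain E where E: "E \<in> \<A>" "(\<Union>n. D n) \<subseteq> E" "measure M E \<le> measure M (\<Union>n. D n) + \<epsilon> / 4"
    using outer[OF D' inc(2), of "\<epsilon> / 4"] Union.prems UN by auto
  have [measurable]: "E \<in> sets M" by (rule A_sets) fact
  have "(\<lambda>n. measure M (C' n)) \<longlonglongrightarrow> measure M (\<Union>n. C' n)"
    by (rule finite_Lim_measure_incseq) (use inc in auto)
  from order_tendstoD(1)[OF this, of "measure M (\<Union>n. C' n) - \<epsilon> / 4"] Union.prems
  obtain n where n: "measure M (\<Union>n. C n) - \<epsilon> / 4 < measure M (C' n)"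
    unfolding UN by (auto simp: eventually_sequentially)
  have sums: "(\<lambda>i. \<epsilon> / 4 * (1 / 2) ^ Suc i) sums (\<epsilon> / 4 * 1)"
    by (intro sums_mult power_half_series)
  have "measure M (\<Union>n. D n) - measure M (\<Union>n. C n) = measure M ((\<Union>n. D n) - (\<Union>n. C n))"
  proof (rule finite_measure_Diff[symmetric])
    show "(\<Union>n. C n) \<subseteq> (\<Union>n. D n)" using CD(3,4) by (intro UN_mono) blast+
  qed auto
  also have "\<dots> \<le> measure M (\<Union>i. D i - C i)"
    by (rule finite_measure_mono) auto
  also have "\<dots> \<le> (\<Sum>i. measure M (D i - C i))"
  proof (rule finite_measure_subadditive_countably)
    show "summable (\<lambda>i. measure M (D i - C i))"
      by (rule summable_comparison_test'[OF sums_summable[OF sums]]) (use CD in auto)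
  qed auto
  also have "\<dots> \<le> \<epsilon> / 4"
    using suminf_le[OF CD(5) _ sums_summable[OF sums]] sums_unique[OF sums]
      summable_comparison_test'[OF sums_summable[OF sums], of 0 "\<lambda>i. measure M (D i - C i)"] CD(5)
    by simp
  finally have DC: "measure M (\<Union>n. D n) - measure M (\<Union>n. C n) \<le> \<epsilon> / 4" .
  have sub: "C' n \<subseteq> (\<Union>i. B i)" "(\<Union>i. B i) \<subseteq> E"
    using CD(3,4) E(2) unfolding C'_def by blast+
  have "measure M (E - C' n) = measure M E - measure M (C' n)"
    using sub by (intro finite_measure_Diff) auto
  then have "measure M (E - C' n) \<le> \<epsilon>"
    using DC E n Union.prems by simp
  moreover have "C' n \<in> \<A>" using C' by blast
  ultimately show ?case using sub E(1) by meson
qed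

text \<open>A set of the completion is a measurable set plus part of a null set, and a null set is
  covered by a member of \<open>\<A>\<close> of small measure because its inner approximation has
  measure 0.\<close>

lemma sandwich_completion:
  assumes B: "B \<in> sets (completion M)" and "0 < (\<epsilon>::real)"
  shows "\<exists>C\<in>\<A>. \<exists>D\<in>\<A>. C \<subseteq> B \<and> B \<subseteq> D \<and> measure M (D - C) \<le> \<epsilon>"
proof -
  obtain S Z Z' where S: "B = S \<union> Z" "Z \<subseteq> Z'" "Z' \<in> null_sets M" "S \<in> sets M"
    using B by (rule sets_completionE)
  then have [measurable]: "S \<in> sets M" "Z' \<in> sets M" by auto
  obtain C D where CD: "C \<in> \<A>" "D \<in> \<A>" "C \<subseteq> S" "S \<subseteq> D" "measure M (D - C) \<le> \<epsilon> / 2"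
    using sandwich[of S "\<epsilon> / 2"] S \<open>0 < \<epsilon>\<close> by auto
  obtain E where E: "E \<in> \<A>" "Z' \<subseteq> E" "measure M E \<le> \<epsilon> / 2"
  proof -
    obtain C E where CE: "C \<in> \<A>" "E \<in> \<A>" "C \<subseteq> Z'" "Z' \<subseteq> E" "measure M (E - C) \<le> \<epsilon> / 2"
      using sandwich[of Z' "\<epsilon> / 2"] S \<open>0 < \<epsilon>\<close> by auto
    have "measure M C \<le> measure M Z'" using CE by (intro finite_measure_mono) auto
    also have "\<dots> = 0" using S by (simp add: measure_eq_0_null_sets)
    finally have "measure M C = 0" by (simp add: antisym)
    then have "measure M (E - C) = measure M E"
      using CE A_sets by (subst finite_measure_Diff) auto
    with CE that show ?thesis by simp
  qed
  have "measure M (D \<union> E - C) \<le> measure M ((D - C) \<union> E)"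
    using CD E A_sets by (intro finite_measure_mono) auto
  also have "\<dots> \<le> measure M (D - C) + measure M E"
    using CD E A_sets by (intro measure_Un_le) auto
  finally have "measure M (D \<union> E - C) \<le> \<epsilon>" using CD E by simp
  with CD E S show ?thesis by (intro bexI[of _ C] bexI[of _ "D \<union> E"]) auto
qed

text \<open>The union of the inner sets and the intersection of the outer sets differ by a null set,
  and \<open>B\<close> lies between them.\<close>

lemma sets_completion_sandwichI:
  assumes "\<And>\<epsilon>::real. 0 < \<epsilon> \<Longrightarrow> \<exists>C\<in>\<A>. \<exists>D\<in>\<A>. C \<subseteq> B \<and> B \<subseteq> D \<and> measure M (D - C) \<le> \<epsilon>"
  shows "B \<in> sets (completion M)"
proof -
  have "\<exists>C\<in>\<A>. \<exists>D\<in>\<A>. C \<subseteq> B \<and> B \<subseteq> D \<and> measure M (D - C) \<le> inverse (real (Suc n))" for n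
    by (rule assms) simp
  then obtain C D where CD: "\<And>n. C n \<in> \<A>" "\<And>n. D n \<in> \<A>" "\<And>n. C n \<subseteq> B" "\<And>n. B \<subseteq> D n"
      "\<And>n. measure M (D n - C n) \<le> inverse (real (Suc n))"
    by metis
  have [measurable]: "\<And>n. C n \<in> sets M" "\<And>n. D n \<in> sets M" using CD by (auto intro: A_sets)
  define Z where "Z = (\<Inter>n. D n) - (\<Union>n. C n)"
  have [measurable]: "Z \<in> sets M" unfolding Z_def by measurable
  have Z: "measure M Z \<le> inverse (real (Suc n))" for n
    by (rule order_trans[OF finite_measure_mono CD(5)]) (auto simp: Z_def)
  have "measure M Z \<le> 0"
    by (rule LIMSEQ_le_const[OF LIMSEQ_inverse_real_of_nat]) (use Z in auto)
  then have "Z \<in> null_sets M"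
    by (auto simp: emeasure_eq_measure measure_le_0_iff)
  moreover have "B = (\<Union>n. C n) \<union> (B - (\<Union>n. C n))" "B - (\<Union>n. C n) \<subseteq> Z"
    using CD(3,4) unfolding Z_def by blast+
  ultimately show ?thesis
    by (intro sets_completionI[of B "\<Union>n. C n" "B - (\<Union>n. C n)" Z]) auto
qed

text \<open>
  The two hypotheses say that passing from \<open>B\<close> to \<open>B'\<close> does not lower the inner measure, neither of
  the set nor of its complement; since the total mass is finite, both are then preserved.
\<close>

lemma completion_inner_measure_preserved:
  assumes B: "B \<in> sets (completion M)" and B': "B' \<subseteq> space M"
    and inner: "\<And>C. C \<in> \<A> \<Longrightarrow> C \<subseteq> B \<Longrightarrow> \<exists>C'\<in>\<A>. C' \<subseteq> B' \<and> measure M C \<le> measure M C'"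
    and inner_compl: "\<And>C. C \<in> \<A> \<Longrightarrow> C \<subseteq> space M - B \<Longrightarrow>
      \<exists>C'\<in>\<A>. C' \<subseteq> space M - B' \<and> measure M C \<le> measure M C'"
  shows "B' \<in> sets (completion M) \<and> emeasure (completion M) B' = emeasure (completion M) B"
proof -
  interpret c: finite_measure "completion M"
    by (rule finite_measureI) (simp add: emeasure_eq_measure)
  have main: "\<exists>C\<in>\<A>. \<exists>D\<in>\<A>. \<exists>C'\<in>\<A>. \<exists>D'\<in>\<A>. C \<subseteq> B \<and> B \<subseteq> D \<and> C' \<subseteq> B' \<and> B' \<subseteq> D' \<and>
      measure M D \<le> measure M C + \<epsilon> \<and> measure M C \<le> measure M C' \<and> measure M D' \<le> measure M D"
    if "0 < \<epsilon>" for \<epsilon> :: real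
  proof -
    obtain C D where CD: "C \<in> \<A>" "D \<in> \<A>" "C \<subseteq> B" "B \<subseteq> D" "measure M (D - C) \<le> \<epsilon>"
      using sandwich_completion[OF B \<open>0 < \<epsilon>\<close>] by auto
    obtain C' where C': "C' \<in> \<A>" "C' \<subseteq> B'" "measure M C \<le> measure M C'"
      using inner[OF CD(1,3)] by auto
    \<comment> \<open>An inner set \<open>E\<close> for the complement of \<open>B'\<close> yields
      the outer set \<open>D' = space M - E\<close> for \<open>B'\<close>.\<close>
    obtain E where E: "E \<in> \<A>" "E \<subseteq> space M - B'" "measure M (space M - D) \<le> measure M E"
      using inner_compl[of "space M - D"] CD(2,4) by auto
    have "measure M (D - C) = measure M D - measure M C"
      using CD A_sets by (intro finite_measure_Diff) auto
    moreover have "measure M (space M - E) \<le> measure M D"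
      using E CD by (simp add: finite_measure_compl A_sets)
    ultimately have "measure M D \<le> measure M C + \<epsilon> \<and> measure M C \<le> measure M C' \<and>
        measure M (space M - E) \<le> measure M D"
      using CD(5) C'(3) by linarith
    moreover have "B' \<subseteq> space M - E" using E(2) B' by blast
    ultimately show ?thesis
      using CD(1-4) C'(1,2) \<A>.compl_sets[OF E(1)] by meson
  qed
  have B'_sets: "B' \<in> sets (completion M)"
  proof (rule sets_completion_sandwichI)
    fix \<epsilon> :: real assume "0 < \<epsilon>"
    from main[OF this] obtain C D C' D' where *: "C' \<in> \<A>" "D' \<in> \<A>" "C' \<subseteq> B'" "B' \<subseteq> D'"
      "measure M D \<le> measure M C + \<epsilon>" "measure M C \<le> measure M C'" "measure M D' \<le> measure M D"
      by blast
    then have "measure M (D' - C') = measure M D' - measure M C'"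
      using A_sets by (intro finite_measure_Diff) auto
    then have "measure M (D' - C') \<le> \<epsilon>" using * by linarith
    with * show "\<exists>C\<in>\<A>. \<exists>D\<in>\<A>. C \<subseteq> B' \<and> B' \<subseteq> D \<and> measure M (D - C) \<le> \<epsilon>" by meson
  qed
  have close: "\<bar>measure (completion M) B' - measure (completion M) B\<bar> \<le> \<epsilon>" if "0 < \<epsilon>" for \<epsilon>
  proof -
    from main[OF that] obtain C D C' D' where
      *: "C \<in> \<A>" "D \<in> \<A>" "C' \<in> \<A>" "D' \<in> \<A>" "C \<subseteq> B" "B \<subseteq> D" "C' \<subseteq> B'" "B' \<subseteq> D'"
      "measure M D \<le> measure M C + \<epsilon>" "measure M C \<le> measure M C'" "measure M D' \<le> measure M D"
      by blast
    have "C \<in> sets (completion M)" "D \<in> sets (completion M)"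
      "C' \<in> sets (completion M)" "D' \<in> sets (completion M)"
      using *(1-4) A_sets by auto
    then have "measure (completion M) C \<le> measure (completion M) B"
      "measure (completion M) B \<le> measure (completion M) D"
      "measure (completion M) C' \<le> measure (completion M) B'"
      "measure (completion M) B' \<le> measure (completion M) D'"
      using *(5-8) B B'_sets by (auto intro!: c.finite_measure_mono simp del: measure_completion)
    moreover have "measure (completion M) C = measure M C" "measure (completion M) D = measure M D"
      "measure (completion M) C' = measure M C'" "measure (completion M) D' = measure M D'"
      using *(1-4) A_sets by (auto intro!: measure_completion)
    ultimately show ?thesis using *(9-11) by linarith
  qed
  have "\<bar>measure (completion M) B' - measure (completion M) B\<bar> \<le> 0"
    by (rule field_le_epsilon) (use close in simp)
  then have "measure (completion M) B' = measure (completion M) B" by linarith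
  with B'_sets show ?thesis using c.emeasure_eq_measure by metis
qed

end

section \<open>Transfer\<close>

primrec fv :: "'u fm \<Rightarrow> nat set" where
  "fv (Rel R vs) = set vs"
| "fv (Eq i j) = {i, j}"
| "fv (Neg f) = fv f"
| "fv (Conj f g) = fv f \<union> fv g"
| "fv (Ex i f) = fv f - {i}"

lemma finite_fv: "finite (fv f)"
  by (induction f) auto

lemma sat_cong: "(\<And>i. i \<in> fv f \<Longrightarrow> e i = e' i) \<Longrightarrow> sat I f e \<longleftrightarrow> sat I f e'"
proof (induction f arbitrary: e e')
  case (Rel R vs)
  then have "map e vs = map e' vs" by simp
  then show ?case by (metis sat.simps(1))
next
  case (Eq i j)
  then show ?case by simp
next
  case (Neg f)
  have "sat I f e \<longleftrightarrow> sat I f e'"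
    by (rule Neg.IH) (simp add: Neg.prems)
  then show ?case by simp
next
  case (Conj f g)
  have "sat I f e \<longleftrightarrow> sat I f e'" "sat I g e \<longleftrightarrow> sat I g e'"
    by (rule Conj.IH, simp add: Conj.prems)+
  then show ?case by simp
next
  case (Ex i f)
  have "sat I f (e(i := x)) \<longleftrightarrow> sat I f (e'(i := x))" for x
    by (rule Ex.IH) (use Ex.prems in auto)
  then show ?case by simp
qed

definition Imp :: "'u fm \<Rightarrow> 'u fm \<Rightarrow> 'u fm" where "Imp f g = Neg (Conj f (Neg g))"
definition Disj :: "'u fm \<Rightarrow> 'u fm \<Rightarrow> 'u fm" where "Disj f g = Neg (Conj (Neg f) (Neg g))"
definition Forall :: "nat \<Rightarrow> 'u fm \<Rightarrow> 'u fm" where "Forall i f = Neg (Ex i (Neg f))"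
definition Iff :: "'u fm \<Rightarrow> 'u fm \<Rightarrow> 'u fm" where "Iff f g = Conj (Imp f g) (Imp g f)"

lemma sat_connectives [simp]:
  "sat I (Imp f g) e \<longleftrightarrow> (sat I f e \<longrightarrow> sat I g e)"
  "sat I (Disj f g) e \<longleftrightarrow> sat I f e \<or> sat I g e"
  "sat I (Forall i f) e \<longleftrightarrow> (\<forall>x. sat I f (e(i := x)))"
  "sat I (Iff f g) e \<longleftrightarrow> (sat I f e \<longleftrightarrow> sat I g e)"
  by (auto simp: Imp_def Disj_def Forall_def Iff_def)

primrec all_below :: "nat \<Rightarrow> 'u fm \<Rightarrow> 'u fm" where
  "all_below 0 f = f"
| "all_below (Suc n) f = Forall n (all_below n f)"

lemma sat_all_below: "sat I (all_below n f) e \<longleftrightarrow> (\<forall>e'. (\<forall>i\<ge>n. e' i = e i) \<longrightarrow> sat I f e')"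
proof (induction n arbitrary: e)
  case 0
  have "(\<forall>i\<ge>0. e' i = e i) \<longleftrightarrow> e' = e" for e' by (auto simp: fun_eq_iff)
  then show ?case by simp
next
  case (Suc n)
  have "(\<exists>x. \<forall>i\<ge>n. e' i = (e(n := x)) i) \<longleftrightarrow> (\<forall>i\<ge>Suc n. e' i = e i)" for e'
    by (auto intro!: exI[of _ "e' n"])
  then show ?case unfolding all_below.simps sat_connectives Suc.IH by blast
qed

locale nonstandard =
  fixes X :: "('u, 'h) extension"
  assumes ext: "nonstandard_extension X"
begin

text \<open>
  Transfer is assumed for standard parameters only; universal closure removes the parameters, so that
  the transferred formula may be instantiated with arbitrary nonstandard elements.
\<close>

lemma transfer:
  assumes "\<And>e. sat (\<lambda>R. R) f e"
  shows "sat (star_rel X) f e"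
proof -
  obtain n where n: "\<And>i. i \<in> fv f \<Longrightarrow> i < n"
    using finite_fv[of f] by (meson finite_nat_set_iff_bounded)
  have "sat (star_rel X) (all_below n f) (star X \<circ> undefined)"
    using ext assms sat_all_below unfolding nonstandard_extension_def by metis
  \<comment> \<open>The closure leaves the variables from \<open>n\<close> on at standard values,
    which is harmless because they are not free in \<open>f\<close>.\<close>
  then have "sat (star_rel X) f (\<lambda>i. if i < n then e i else (star X \<circ> undefined) i)"
    unfolding sat_all_below by simp
  then show ?thesis
    using sat_cong[of f "\<lambda>i. if i < n then e i else (star X \<circ> undefined) i" e "star_rel X"] n
    by simp
qed

lemma real_in_eq [simp]: "real_in X a = real_in X b \<longleftrightarrow> a = b"
  using ext by (auto simp: nonstandard_extension_def inj_def)

lemma set_in_eq [simp]: "set_in X A = set_in X B \<longleftrightarrow> A = B"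
  using ext by (auto simp: nonstandard_extension_def inj_def)

text \<open>The formulas have no constants; a standard element enters them through its singleton
  relation.\<close>

lemma star_singleton: "[star X a] \<in> star_rel X {[a]}"
proof -
  have "sat (star_rel X) (Rel {[a]} [0]) (star X \<circ> (\<lambda>_. a))"
    using ext unfolding nonstandard_extension_def by (metis insertI1 list.simps(8,9) sat.simps(1))
  then show ?thesis by simp
qed

abbreviation "rel1 P \<equiv> {[real_in X a] | a. P a}"
abbreviation "rel2 P \<equiv> {[real_in X a, real_in X b] | a b. P a b}"
abbreviation "rel3 P \<equiv> {[real_in X a, real_in X b, real_in X c] | a b c. P a b c}"
abbreviation "graph f \<equiv> {[real_in X a, real_in X b, real_in X (f a b)] | a b. True}"
abbreviation "nats \<equiv> {[real_in X (real n)] | n. n \<ge> 1}"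
abbreviation "leq \<equiv> {[real_in X a, real_in X b] | a b. a \<le> b}"

text \<open>The pattern of the transfer arguments: a formula valid under all standard assignments is
  evaluated at \<open>(!) [x, y]\<close>, so list positions are the variable numbers.\<close>

lemma hle_linear: "x \<in> hypnat X \<Longrightarrow> y \<in> hypnat X \<Longrightarrow> hle X x y \<or> hle X y x"
proof -
  have "sat (star_rel X) (Imp (Conj (Rel nats [0]) (Rel nats [1])) (Disj (Rel leq [0,1]) (Rel leq [1,0]))) ((!) [x, y])"
    by (rule transfer) (auto simp: linear)
  then show "x \<in> hypnat X \<Longrightarrow> y \<in> hypnat X \<Longrightarrow> hle X x y \<or> hle X y x"
    by (simp add: hypnat_def hle_def)
qed

lemma hfun2_unique:
  assumes "[x, y, z] \<in> star_rel X (graph f)"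
  shows "hfun2 X f x y = z"
proof -
  have "sat (star_rel X) (Imp (Conj (Rel (graph f) [0,1,2]) (Rel (graph f) [0,1,3])) (Eq 2 3)) ((!) [x, y, w, z])" for w
    by (rule transfer) auto
  then have "w = z" if "[x, y, w] \<in> star_rel X (graph f)" for w
    using assms that by simp
  then show ?thesis
    unfolding hfun2_def using assms by blast
qed

text \<open>The hypotheses ensure that \<open>x\<close> and \<open>y\<close> are hyperreal; only
  there does the graph provide a value for the description in \<open>hfun2\<close>.\<close>

lemma hfun2_graph:
  assumes "[x] \<in> star_rel X (rel1 P)" "[y] \<in> star_rel X (rel1 Q)"
  shows "[x, y, hfun2 X f x y] \<in> star_rel X (graph f)"
proof -
  have "sat (star_rel X) (Imp (Conj (Rel (rel1 P) [0]) (Rel (rel1 Q) [1])) (Ex 2 (Rel (graph f) [0,1,2]))) ((!) [x, y])"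
    by (rule transfer) auto
  then obtain z where "[x, y, z] \<in> star_rel X (graph f)"
    using assms by auto
  with hfun2_unique[OF this] show ?thesis by simp
qed

end

section \<open>Cut equivalence\<close>

text \<open>This is the quotient tested by \<open>cut_equiv\<close>, taken as larger over smaller so
  that the case distinction on the order disappears.\<close>

definition fratio :: "real \<Rightarrow> real \<Rightarrow> real" where
  "fratio a b = of_int \<lfloor>max a b / min a b\<rfloor>"

lemma max_div_min_le_iff:
  fixes a b k :: real
  assumes "0 < a" "0 < b" "1 \<le> k"
  shows "max a b / min a b \<le> k \<longleftrightarrow> a \<le> k * b \<and> b \<le> k * a"
proof -
  have "a \<le> k * a" "b \<le> k * b" using assms by simp_all
  then have "a \<le> b \<Longrightarrow> a \<le> k * b" "\<not> a \<le> b \<Longrightarrow> b \<le> k * a" by linarith+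
  then show ?thesis using assms by (auto simp: max_def min_def divide_le_eq)
qed

lemma one_le_max_div_min: "0 < a \<Longrightarrow> 0 < b \<Longrightarrow> 1 \<le> max a b / min a b" for a b :: real
  by (auto simp: max_def min_def)

text \<open>Rounding down a number that is at least 1 loses less than a factor 2, so
  \<open>fratio\<close> may replace the exact ratio up to that factor.\<close>

lemma fratio_bounds:
  assumes "0 < a" "0 < b"
  shows "1 \<le> fratio a b" "fratio a b \<le> max a b / min a b" "max a b / min a b \<le> 2 * fratio a b"
proof -
  show *: "1 \<le> fratio a b"
    using one_le_max_div_min[OF assms] unfolding fratio_def by (simp add: le_floor_iff)
  show "fratio a b \<le> max a b / min a b" unfolding fratio_def by linarith
  show "max a b / min a b \<le> 2 * fratio a b" using * unfolding fratio_def by linarith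
qed

lemma fratio_le:
  assumes "0 < a" "0 < b" "a \<le> k * b" "b \<le> k * a"
  shows "fratio a b \<le> k"
proof -
  \<comment> \<open>Otherwise \<open>a \<le> k * b < b\<close> and
    \<open>b \<le> k * a < a\<close>.\<close>
  have "1 \<le> k"
  proof (rule ccontr)
    assume "\<not> 1 \<le> k"
    then have "k * b < b" "k * a < a" using assms by simp_all
    with assms show False by linarith
  qed
  with assms max_div_min_le_iff[of a b k] fratio_bounds(2)[of a b] show ?thesis by linarith
qed

lemma fratio_commute: "fratio a b = fratio b a"
  by (simp add: fratio_def max.commute min.commute)

text \<open>Exact ratios are submultiplicative; each of the two roundings on the right costs a
  factor 2.\<close>

lemma fratio_triangle:
  assumes "0 < a" "0 < b" "0 < c"
  shows "fratio a c \<le> 4 * fratio a b * fratio b c"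
proof -
  have *: "a \<le> 2 * fratio a b * b" "b \<le> 2 * fratio a b * a" "b \<le> 2 * fratio b c * c" "c \<le> 2 * fratio b c * b"
    using max_div_min_le_iff[of a b "2 * fratio a b"] max_div_min_le_iff[of b c "2 * fratio b c"]
      fratio_bounds[of a b] fratio_bounds[of b c] assms by auto
  have p: "0 \<le> 2 * fratio a b" "0 \<le> 2 * fratio b c" using fratio_bounds[of a b] fratio_bounds[of b c] assms by auto
  show ?thesis
  proof (rule fratio_le)
    show "a \<le> 4 * fratio a b * fratio b c * c"
      using order_trans[OF *(1) mult_left_mono[OF *(3) p(1)]] by (simp add: algebra_simps)
    show "c \<le> 4 * fratio a b * fratio b c * a"
      using order_trans[OF *(4) mult_left_mono[OF *(2) p(2)]] by (simp add: algebra_simps)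
  qed (use assms in auto)
qed

lemma floor_div_bounds:
  fixes n u :: real
  assumes "0 < u" "u \<le> n"
  shows "1 \<le> real_of_int \<lfloor>n / u\<rfloor>" "of_int \<lfloor>n / u\<rfloor> * u \<le> n" "n < 2 * of_int \<lfloor>n / u\<rfloor> * u"
proof -
  have "1 \<le> n / u" using assms by simp
  then show *: "1 \<le> real_of_int \<lfloor>n / u\<rfloor>" by (simp add: le_floor_iff)
  have "of_int \<lfloor>n / u\<rfloor> \<le> n / u" by linarith
  then show "of_int \<lfloor>n / u\<rfloor> * u \<le> n" by (rule pos_le_divide_eq[OF assms(1), THEN iffD1])
  have "n / u < 2 * of_int \<lfloor>n / u\<rfloor>" using * by linarith
  then show "n < 2 * of_int \<lfloor>n / u\<rfloor> * u" using assms by (simp add: field_simps)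
qed

text \<open>Both \<open>s * u\<close> and \<open>t * v\<close> agree with \<open>n\<close> up to a
  factor 2, so the ratio of \<open>s\<close> and \<open>t\<close> is controlled by that of
  \<open>u\<close> and \<open>v\<close>.\<close>

lemma fratio_floor_div:
  fixes n u v :: real
  assumes u: "0 < u" "u \<le> n" and v: "0 < v" "v \<le> n"
  defines "s \<equiv> real_of_int \<lfloor>n / u\<rfloor>" and "t \<equiv> real_of_int \<lfloor>n / v\<rfloor>"
  shows "fratio s t \<le> 4 * fratio u v * fratio u v"
proof -
  define r where "r = fratio u v"
  have r: "1 \<le> r" "u \<le> 2 * r * v" "v \<le> 2 * r * u"
    using max_div_min_le_iff[of u v "2 * r"] fratio_bounds[of u v] u v by (auto simp: r_def)
  have s: "1 \<le> s" "s * u \<le> n" "n < 2 * s * u" and t: "1 \<le> t" "t * v \<le> n" "n < 2 * t * v"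
    using floor_div_bounds u v by (simp_all add: s_def t_def)
  have *: "s' \<le> 4 * r * t'" if "1 \<le> s'" "1 \<le> t'" "s' * u' \<le> n" "n < 2 * t' * v'" "v' \<le> 2 * r * u'" "0 < u'"
    for s' t' u' v' :: real
  proof -
    have "s' * u' \<le> 2 * t' * v'" using that by linarith
    also have "\<dots> \<le> 2 * t' * (2 * r * u')" using that by (intro mult_left_mono) auto
    also have "\<dots> = (4 * r * t') * u'" by simp
    finally show ?thesis using \<open>0 < u'\<close> by (simp only: mult_le_cancel_right_pos)
  qed
  have "fratio s t \<le> 4 * r"
    using s t r u v * by (intro fratio_le) auto
  \<comment> \<open>The bound \<open>4 * r\<close> is weakened to the shape of
    \<open>fratio_triangle\<close>, so that one absorption lemma for cuts serves both.\<close>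
  also have "\<dots> \<le> 4 * r * r" using r(1) by simp
  finally show ?thesis by (simp add: r_def)
qed

text \<open>From \<open>s * u \<le> n < 2 * s * u\<close> the second quotient lies between
  \<open>u\<close> inclusive and \<open>2 * u\<close> exclusive, so its ratio to \<open>u\<close>
  rounds down to 1.\<close>

lemma fratio_floor_div_floor_div:
  fixes n u :: nat
  assumes "1 \<le> u" "u \<le> n"
  defines "s \<equiv> real_of_int \<lfloor>real n / real u\<rfloor>"
  shows "fratio (real_of_int \<lfloor>n / s\<rfloor>) u = 1"
proof -
  have s: "1 \<le> s" "s * u \<le> n" "n < 2 * s * u"
    using floor_div_bounds[of "real u" "real n"] assms by (simp_all add: s_def)
  have "real u \<le> n / s" "n / s < 2 * u" using s by (simp_all add: field_simps)
  then have "int u \<le> \<lfloor>n / s\<rfloor>" and t': "\<lfloor>n / s\<rfloor> < 2 * real u"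
    using of_int_floor_le[of "n / s"] by (simp add: le_floor_iff, linarith)
  then have t: "real u \<le> \<lfloor>n / s\<rfloor>" by linarith
  have "1 \<le> \<lfloor>n / s\<rfloor> / real u" "\<lfloor>n / s\<rfloor> / real u < 2" using t t' assms by (simp_all add: field_simps)
  then have "\<lfloor>\<lfloor>n / s\<rfloor> / real u\<rfloor> = 1" by linarith
  then show ?thesis using t assms(1) by (simp add: fratio_def max_def min_def)
qed

lemma of_int_floor_nat: "\<exists>k. real_of_int \<lfloor>real n / real u\<rfloor> = real k"
  by (metis floor_divide_of_nat_eq of_int_of_nat_eq)

lemma fratio_nat:
  assumes "1 \<le> a" "1 \<le> b"
  shows "\<exists>k\<ge>1. fratio (real a) (real b) = real k"
proof -
  have "fratio (real a) (real b) = real (max a b div min a b)"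
    unfolding fratio_def
    by (metis (no_types, lifting) floor_divide_of_nat_eq of_int_of_nat_eq of_nat_max of_nat_min)
  moreover have "1 \<le> fratio (real a) (real b)" using assms by (intro fratio_bounds) auto
  ultimately show ?thesis by (metis of_nat_1 of_nat_le_iff)
qed

section \<open>Transfer of the ratio estimates to hypernaturals\<close>

context nonstandard begin

abbreviation "quot_graph \<equiv> graph (\<lambda>a b. of_int \<lfloor>a / b\<rfloor>)"

lemma hypnat_graph:
  assumes "x \<in> hypnat X" "y \<in> hypnat X"
  shows "[x, y, hfun2 X f x y] \<in> star_rel X (graph f)"
proof -
  have eq: "rel1 (\<lambda>a. \<exists>n. a = real n \<and> n \<ge> 1) = nats" by auto
  show ?thesis
    using hfun2_graph[of x "\<lambda>a. \<exists>n. a = real n \<and> n \<ge> 1" y "\<lambda>a. \<exists>n. a = real n \<and> n \<ge> 1" f] assms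
    unfolding eq hypnat_def by simp
qed

lemma hquot_hypnat:
  assumes "x \<in> hypnat X" "y \<in> hypnat X" "hle X x y"
  shows "hquot X y x \<in> hypnat X" "hle X (hquot X y x) y"
proof -
  have "sat (star_rel X) (Imp (Conj (Rel nats [0]) (Conj (Rel nats [1]) (Conj (Rel leq [0,1])
      (Rel quot_graph [1,0,2])))) (Conj (Rel nats [2]) (Rel leq [2,1]))) ((!) [x, y, hquot X y x])"
  proof (rule transfer, clarsimp)
    fix n m :: nat assume nm: "Suc 0 \<le> n" "n \<le> m"
    then obtain k where k: "real_of_int \<lfloor>real m / real n\<rfloor> = real k" using of_int_floor_nat by blast
    then have "1 \<le> real k" "real k * real n \<le> real m"
      using floor_div_bounds[of n m] nm by simp_all
    moreover have "real k * 1 \<le> real k * real n" using nm by (intro mult_left_mono) auto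
    ultimately have "Suc 0 \<le> k" "real k \<le> real m" by (simp, linarith)
    then show "(\<exists>k. real_of_int \<lfloor>real m / real n\<rfloor> = real k \<and> Suc 0 \<le> k) \<and> real_of_int \<lfloor>real m / real n\<rfloor> \<le> real m"
      using k by auto
  qed
  then show "hquot X y x \<in> hypnat X" "hle X (hquot X y x) y"
    using assms hypnat_graph[OF assms(2,1)] by (simp_all add: hypnat_def hle_def hquot_def)
qed

definition hratio :: "'h \<Rightarrow> 'h \<Rightarrow> 'h" where
  "hratio = hfun2 X fratio"

lemma hratio_hypnat:
  assumes "x \<in> hypnat X" "y \<in> hypnat X"
  shows "hratio x y \<in> hypnat X"
proof -
  have "sat (star_rel X) (Imp (Conj (Rel nats [0]) (Conj (Rel nats [1])
      (Rel (graph fratio) [0,1,2]))) (Rel nats [2])) ((!) [x, y, hratio x y])"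
    by (rule transfer) (use fratio_nat in \<open>clarsimp, metis\<close>)
  then show ?thesis
    using assms hypnat_graph[OF assms, of fratio] by (simp add: hypnat_def hratio_def)
qed

lemma hratio_commute:
  assumes "x \<in> hypnat X" "y \<in> hypnat X"
  shows "hratio x y = hratio y x"
proof -
  have "sat (star_rel X) (Imp (Rel (graph fratio) [0,1,2]) (Rel (graph fratio) [1,0,2])) ((!) [x, y, hratio x y])"
    by (rule transfer) (auto simp: fratio_commute)
  then have "[y, x, hratio x y] \<in> star_rel X (graph fratio)"
    using hypnat_graph[OF assms, of fratio] by (simp add: hratio_def)
  then show ?thesis unfolding hratio_def by (rule hfun2_unique[symmetric])
qed

lemma hquot_eq_hratio:
  assumes "x \<in> hypnat X" "y \<in> hypnat X" "hle X x y"
  shows "hquot X y x = hratio x y"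
proof -
  have "sat (star_rel X) (Imp (Conj (Rel leq [0,1]) (Rel (graph fratio) [0,1,2]))
      (Rel quot_graph [1,0,2])) ((!) [x, y, hratio x y])"
    by (rule transfer) (auto simp: fratio_def)
  then have "[y, x, hratio x y] \<in> star_rel X quot_graph"
    using assms hypnat_graph[OF assms(1,2), of fratio] by (simp add: hle_def hratio_def)
  then show ?thesis unfolding hquot_def by (rule hfun2_unique)
qed

text \<open>The value is 1, expressed as minimality because a nonempty initial segment contains
  every hypernatural below one of its elements.\<close>

lemma hratio_least:
  assumes "x \<in> hypnat X" "y \<in> hypnat X"
  shows "hle X (hratio x x) y"
proof -
  have "sat (star_rel X) (Imp (Conj (Rel nats [0]) (Conj (Rel nats [1]) (Rel (graph fratio) [0,0,2])))
      (Rel leq [2,1])) ((!) [x, y, hratio x x])"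
    by (rule transfer) (auto simp: fratio_def)
  then show ?thesis
    using assms hypnat_graph[of x x fratio] by (simp add: hypnat_def hle_def hratio_def)
qed

text \<open>The inequality is kept as membership in an extended relation, which avoids developing
  hyperreal arithmetic.\<close>

lemma hratio_triangle:
  assumes "x \<in> hypnat X" "y \<in> hypnat X" "z \<in> hypnat X"
  shows "[hratio x z, hratio x y, hratio y z] \<in> star_rel X (rel3 (\<lambda>r p q. r \<le> 4 * p * q))"
proof -
  have "sat (star_rel X) (Imp (Conj (Rel nats [0]) (Conj (Rel nats [1]) (Conj (Rel nats [2])
      (Conj (Rel (graph fratio) [0,2,3]) (Conj (Rel (graph fratio) [0,1,4]) (Rel (graph fratio) [1,2,5]))))))
      (Rel (rel3 (\<lambda>r p q. r \<le> 4 * p * q)) [3,4,5])) ((!) [x, y, z, hratio x z, hratio x y, hratio y z])"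
    by (rule transfer) (clarsimp, intro fratio_triangle, auto)
  then show ?thesis
    using assms hypnat_graph[of _ _ fratio] by (simp add: hypnat_def hratio_def)
qed

lemma hratio_hquot:
  assumes "N \<in> hypnat X" "u \<in> hypnat X" "v \<in> hypnat X" "hle X u N" "hle X v N"
  shows "[hratio (hquot X N u) (hquot X N v), hratio u v, hratio u v]
    \<in> star_rel X (rel3 (\<lambda>r p q. r \<le> 4 * p * q))"
proof -
  let ?s = "hquot X N u" and ?t = "hquot X N v"
  have st: "?s \<in> hypnat X" "?t \<in> hypnat X" using assms hquot_hypnat by auto
  have "sat (star_rel X) (Imp (Conj (Rel nats [1]) (Conj (Rel nats [2]) (Conj (Rel leq [1,0]) (Conj (Rel leq [2,0])
      (Conj (Rel quot_graph [0,1,3]) (Conj (Rel quot_graph [0,2,4])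
      (Conj (Rel (graph fratio) [3,4,5]) (Rel (graph fratio) [1,2,6]))))))))
      (Rel (rel3 (\<lambda>r p q. r \<le> 4 * p * q)) [5,6,6])) ((!) [N, u, v, ?s, ?t, hratio ?s ?t, hratio u v])"
    by (rule transfer) (clarsimp, intro fratio_floor_div, auto)
  then show ?thesis
    using assms st hypnat_graph[of _ _ fratio] hypnat_graph[of _ _ "\<lambda>a b. of_int \<lfloor>a / b\<rfloor>"]
    by (simp add: hypnat_def hratio_def hquot_def hle_def)
qed

text \<open>Here \<open>hratio u u\<close> serves as a name for 1; that it belongs to a cut is
  reflexivity of the cut equivalence.\<close>

lemma hratio_hquot_hquot:
  assumes "N \<in> hypnat X" "u \<in> hypnat X" "hle X u N"
  shows "hratio (hquot X N (hquot X N u)) u = hratio u u"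
proof -
  let ?s = "hquot X N u"
  let ?t = "hquot X N ?s"
  have s: "?s \<in> hypnat X" "hle X ?s N" using assms hquot_hypnat by auto
  then have t: "?t \<in> hypnat X" using assms hquot_hypnat by auto
  have "sat (star_rel X) (Imp (Conj (Rel nats [0]) (Conj (Rel nats [1]) (Conj (Rel leq [1,0])
      (Conj (Rel quot_graph [0,1,2]) (Conj (Rel quot_graph [0,2,3]) (Rel (graph fratio) [1,1,4]))))))
      (Rel (graph fratio) [3,1,4])) ((!) [N, u, ?s, ?t, hratio u u])"
  proof (rule transfer, clarsimp)
    fix n m :: nat assume "Suc 0 \<le> m" "m \<le> n"
    moreover have "fratio m m = 1" using \<open>Suc 0 \<le> m\<close> by (simp add: fratio_def)
    ultimately show "fratio m m = fratio (real_of_int \<lfloor>real n / real_of_int \<lfloor>real n / real m\<rfloor>\<rfloor>) m"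
      using fratio_floor_div_floor_div[of m n] by simp
  qed
  then have "[?t, u, hratio u u] \<in> star_rel X (graph fratio)"
    using assms s t hypnat_graph[of _ _ fratio] hypnat_graph[of _ _ "\<lambda>a b. of_int \<lfloor>a / b\<rfloor>"]
    by (simp add: hypnat_def hratio_def hquot_def hle_def)
  then show ?thesis unfolding hratio_def by (rule hfun2_unique)
qed

lemma cut_equiv_iff:
  assumes "x \<in> hypnat X" "y \<in> hypnat X"
  shows "cut_equiv X V x y \<longleftrightarrow> hratio x y \<in> V"
  using assms hquot_eq_hratio hle_linear hratio_commute unfolding cut_equiv_def by metis

end

section \<open>Multiplicative cuts and their equivalence relation\<close>

locale cut = nonstandard X for X :: "('u, 'h) extension" +
  fixes V :: "'h set"
  assumes cut: "multiplicative_cut X V"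
begin

lemma cut_hypnat: "x \<in> V \<Longrightarrow> x \<in> hypnat X"
  and cut_initial: "x \<in> V \<Longrightarrow> y \<in> hypnat X \<Longrightarrow> hle X y x \<Longrightarrow> y \<in> V"
  and cut_mult: "x \<in> V \<Longrightarrow> y \<in> V \<Longrightarrow> hmult X x y \<in> V"
  and cut_infinite: "infinite V"
  using cut unfolding multiplicative_cut_def by auto

text \<open>A cut absorbs the constant 4: being infinite, it has two elements \<open>s < t\<close>,
  so \<open>t\<close> is at least 2, and closure under products puts \<open>t * t * p * q\<close>,
  which bounds \<open>4 * p * q\<close>, into \<open>V\<close>.\<close>

lemma cut_boundI:
  assumes "r \<in> hypnat X" "p \<in> V" "q \<in> V" "[r, p, q] \<in> star_rel X (rel3 (\<lambda>r p q. r \<le> 4 * p * q))"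
  shows "r \<in> V"
proof -
  obtain s t where st: "s \<in> V" "t \<in> V" "hle X s t" "s \<noteq> t"
  proof -
    obtain s where s: "s \<in> V" using cut_infinite by (metis finite.emptyI ex_in_conv)
    moreover obtain t where t: "t \<in> V" "t \<noteq> s"
      using cut_infinite infinite_remove[of V s] by (metis Diff_iff ex_in_conv finite.emptyI insertI1)
    ultimately show ?thesis using that hle_linear cut_hypnat by metis
  qed
  let ?tt = "hmult X t t" and ?pq = "hmult X p q"
  let ?m = "hmult X ?tt ?pq"
  have V: "?tt \<in> V" "?pq \<in> V" "?m \<in> V" using st assms cut_mult by auto
  let ?g = "graph (\<lambda>a b. a * b)"
  have "sat (star_rel X) (Imp (Conj (Rel nats [0]) (Conj (Rel nats [1]) (Conj (Rel leq [0,1]) (Conj (Neg (Eq 0 1))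
      (Conj (Rel nats [3]) (Conj (Rel nats [4]) (Conj (Rel (rel3 (\<lambda>r p q. r \<le> 4 * p * q)) [2,3,4])
      (Conj (Rel ?g [1,1,5]) (Conj (Rel ?g [3,4,6]) (Rel ?g [5,6,7]))))))))))
      (Rel leq [2,7])) ((!) [s, t, r, p, q, ?tt, ?pq, ?m])"
  proof (rule transfer, clarsimp)
    fix n m k l :: nat and r :: real
    assume *: "Suc 0 \<le> n" "n \<le> m" "n \<noteq> m" "r \<le> 4 * real k * real l"
    then have "2 * 2 \<le> real m * real m" by (intro mult_mono) auto
    then have "4 * (real k * real l) \<le> real m * real m * (real k * real l)" by (intro mult_right_mono) auto
    with * show "r \<le> real m * real m * (real k * real l)" by simp
  qed
  then have "hle X r ?m"
    using st assms V cut_hypnat hypnat_graph[of _ _ "\<lambda>a b. a * b"]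
    by (simp add: hypnat_def hmult_def hle_def subset_iff)
  with cut_initial V assms(1) show ?thesis by blast
qed

lemma cut_equiv_refl: "x \<in> hypnat X \<Longrightarrow> cut_equiv X V x x"
  using cut_infinite hratio_least cut_initial cut_hypnat hratio_hypnat cut_equiv_iff
  by (metis finite.emptyI ex_in_conv)

lemma cut_equiv_sym: "x \<in> hypnat X \<Longrightarrow> y \<in> hypnat X \<Longrightarrow> cut_equiv X V x y \<Longrightarrow> cut_equiv X V y x"
  using cut_equiv_iff hratio_commute by metis

lemma cut_equiv_trans:
  assumes "x \<in> hypnat X" "y \<in> hypnat X" "z \<in> hypnat X" "cut_equiv X V x y" "cut_equiv X V y z"
  shows "cut_equiv X V x z"
  using assms cut_boundI[OF _ _ _ hratio_triangle[OF assms(1-3)]] hratio_hypnat by (simp add: cut_equiv_iff)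

lemma cut_class_eq_iff:
  assumes "x \<in> hypnat X" "y \<in> hypnat X"
  shows "cut_class X V x = cut_class X V y \<longleftrightarrow> cut_equiv X V x y"
proof
  assume "cut_class X V x = cut_class X V y"
  then show "cut_equiv X V x y"
    using assms cut_equiv_refl[of y] unfolding cut_class_def by blast
next
  assume "cut_equiv X V x y"
  then show "cut_class X V x = cut_class X V y"
    unfolding cut_class_def using assms cut_equiv_sym cut_equiv_trans by blast
qed

lemma cut_equiv_hquot:
  assumes "N \<in> hypnat X" "u \<in> hypnat X" "v \<in> hypnat X" "hle X u N" "hle X v N" "cut_equiv X V u v"
  shows "cut_equiv X V (hquot X N u) (hquot X N v)"
  using assms cut_boundI[OF _ _ _ hratio_hquot[OF assms(1-5)]] hratio_hypnat hquot_hypnat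
  by (simp add: cut_equiv_iff)

lemma cut_equiv_hquot_hquot:
  assumes "N \<in> hypnat X" "u \<in> hypnat X" "hle X u N"
  shows "cut_equiv X V (hquot X N (hquot X N u)) u"
  using assms hratio_hquot_hquot[OF assms] cut_equiv_refl[of u] hquot_hypnat cut_equiv_iff by metis

end

section \<open>Internal sets and logarithmic sums\<close>

text \<open>An initial segment of the naturals with a real bound, as a set of reals, so that
  \<open>set_in\<close> and \<open>real_in\<close> can name it and its bound; its extension at
  \<open>N\<close> is the interval \<open>S\<close>.\<close>

definition natle :: "real \<Rightarrow> real set" where
  "natle n = {real k | k. 1 \<le> k \<and> real k \<le> n}"

lemma finite_natle: "finite (natle n)"
proof -
  have "natle n \<subseteq> real ` {..nat \<lfloor>n\<rfloor>}" by (auto simp: natle_def le_nat_floor)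
  then show ?thesis by (rule finite_subset) simp
qed

lemma natle_of_nat: "natle (real m) = real ` {1..m}"
  by (auto simp: natle_def)

lemma log_sum_eq: "(\<Sum>a\<in>A. 1 / (a * ln n)) = (\<Sum>a\<in>A. 1 / a) / ln (n :: real)"
  by (simp add: sum_divide_distrib)

text \<open>These bounds give the logarithmic sums standard parts. For \<open>3 \<le> m\<close> one
  has \<open>1 \<le> ln m\<close>, and the full harmonic sum is at most
  \<open>1 + ln m\<close>.\<close>

lemma harmonic_log_sum_bounds:
  assumes "A \<subseteq> natle (real m)" "3 \<le> m"
  shows "0 \<le> (\<Sum>a\<in>A. 1 / (a * ln (real m)))" "(\<Sum>a\<in>A. 1 / (a * ln (real m))) \<le> 2"
proof -
  have ln: "1 \<le> ln (real m)"
    using assms(2) exp_le by (subst ln_ge_iff) (auto intro: order_trans[of _ 3])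
  have pos: "0 \<le> 1 / (a * ln (real m))" if "a \<in> natle (real m)" for a
    using that ln by (auto simp: natle_def)
  then show "0 \<le> (\<Sum>a\<in>A. 1 / (a * ln (real m)))" using assms(1) by (intro sum_nonneg) auto
  have "(\<Sum>a\<in>A. 1 / (a * ln (real m))) \<le> (\<Sum>a\<in>natle (real m). 1 / (a * ln (real m)))"
    using assms(1) pos finite_natle by (intro sum_mono2) auto
  also have "\<dots> = (\<Sum>k=1..m. 1 / real k) / ln (real m)"
    unfolding log_sum_eq natle_of_nat by (subst sum.reindex) (auto simp: o_def)
  also have "\<dots> = harm m / ln (real m)" by (simp add: harm_def inverse_eq_divide)
  also have "\<dots> \<le> (1 + ln (real m)) / ln (real m)"
  proof -
    obtain k where k: "m = Suc k" using assms(2) by (cases m) auto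
    \<comment> \<open>The difference between harmonic number and logarithm decreases, starting from
      the value 1 at index \<open>Suc 0\<close>.\<close>
    have "harm (Suc k) - ln (real (Suc k)) \<le> harm (Suc 0) - ln (real (Suc 0))"
      using decseqD[OF decseq_harm_diff_ln, of 0 k] by simp
    then show ?thesis using k ln by (intro divide_right_mono) (auto simp: harm_def)
  qed
  also have "\<dots> \<le> 2" using ln by (simp add: field_simps)
  finally show "(\<Sum>a\<in>A. 1 / (a * ln (real m))) \<le> 2" .
qed

text \<open>Bundling the properties of the reflected set into one relation lets its existence
  transfer to the existence of an internal set.\<close>

definition reflected :: "real \<Rightarrow> real set \<Rightarrow> real set \<Rightarrow> bool" where
  "reflected n A A' \<longleftrightarrow> A' \<subseteq> natle n \<and>
     (\<forall>x\<in>A'. \<exists>u\<in>A. x = of_int \<lfloor>n / u\<rfloor> \<or> u = of_int \<lfloor>n / x\<rfloor>) \<and>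
     (\<Sum>a\<in>A. 1 / a) \<le> (\<Sum>a\<in>A'. 1 / a) + 4"

lemma ex_reflected:
  assumes "1 \<le> m" "A \<subseteq> natle (real m)"
  shows "\<exists>A'. reflected (real m) A A'"
proof -
  define B where "B = {k \<in> {1..m}. real k \<in> A}"
  have A: "A = real ` B" using assms(2) by (auto simp: natle_of_nat B_def)
  have B_sub: "B \<subseteq> {1..m}" by (auto simp: B_def)
  obtain B' where B': "B' \<subseteq> {1..m}" "\<And>x. x \<in> B' \<Longrightarrow> \<exists>u\<in>B. x = m div u \<or> u = m div x"
    "(\<Sum>a\<in>B. 1 / real a) \<le> (\<Sum>a\<in>B'. 1 / real a) + 4"
    using B_sub by (rule harmonic_sum_reflection[OF assms(1)]) (rule that)
  have sum: "(\<Sum>a\<in>real ` C. 1 / a) = (\<Sum>a\<in>C. 1 / real a)" for C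
    by (subst sum.reindex) auto
  have "reflected (real m) A (real ` B')"
    unfolding reflected_def A sum
  proof (intro conjI ballI)
    show "real ` B' \<subseteq> natle (real m)" using B'(1) by (auto simp: natle_of_nat)
    fix x assume "x \<in> real ` B'"
    then obtain y where y: "x = real y" "y \<in> B'" by auto
    with B'(2) obtain u where "u \<in> B" "y = m div u \<or> u = m div y" by blast
    then show "\<exists>u\<in>real ` B. x = of_int \<lfloor>real m / u\<rfloor> \<or> u = of_int \<lfloor>real m / x\<rfloor>"
      using y by (intro bexI[of _ "real u"]) (auto simp: floor_divide_of_nat_eq)
  qed (rule B'(3))
  then show ?thesis by blast
qed

text \<open>After normalisation the error is \<open>4 / ln n\<close>, at most
  \<open>\<epsilon>\<close> once \<open>n\<close> reaches \<open>exp (4 / \<epsilon>)\<close>; an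
  infinite \<open>N\<close> passes this threshold for every standard
  \<open>\<epsilon>\<close>.\<close>

lemma reflected_log_sum:
  assumes "reflected n A A'" "0 < \<epsilon>" "exp (4 / \<epsilon>) \<le> n"
  shows "(\<Sum>a\<in>A. 1 / (a * ln n)) \<le> (\<Sum>a\<in>A'. 1 / (a * ln n)) + \<epsilon>"
proof -
  have "0 < n" using assms(3) by (rule less_le_trans[OF exp_gt_zero])
  then have ln: "4 / \<epsilon> \<le> ln n" using assms(3) by (simp add: ln_ge_iff)
  moreover have "0 < 4 / \<epsilon>" using assms(2) by simp
  ultimately have "0 < ln n" by linarith
  have "(\<Sum>a\<in>A. 1 / a) / ln n \<le> ((\<Sum>a\<in>A'. 1 / a) + 4) / ln n"
    using assms(1) \<open>0 < ln n\<close> by (intro divide_right_mono) (auto simp: reflected_def)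
  moreover have "4 / ln n \<le> \<epsilon>"
    using ln \<open>0 < ln n\<close> assms(2) by (simp add: field_simps)
  ultimately show ?thesis unfolding log_sum_eq by (simp add: add_divide_distrib)
qed

section \<open>Standard parts of bounded hyperreals\<close>

context nonstandard begin

lemma rel1_conj:
  assumes "[z] \<in> star_rel X (rel1 P)" "[z] \<in> star_rel X (rel1 Q)" "\<And>y. P y \<Longrightarrow> Q y \<Longrightarrow> R y"
  shows "[z] \<in> star_rel X (rel1 R)"
proof -
  have "sat (star_rel X) (Imp (Conj (Rel (rel1 P) [0]) (Rel (rel1 Q) [0])) (Rel (rel1 R) [0])) ((!) [z])"
    by (rule transfer) (use assms(3) in auto)
  then show ?thesis using assms by simp
qed

lemma rel1_False:
  assumes "[z] \<in> star_rel X (rel1 P)" "\<And>y. \<not> P y"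
  shows False
proof -
  have "sat (star_rel X) (Neg (Rel (rel1 P) [0])) ((!) [z])"
    by (rule transfer) (use assms(2) in auto)
  then show ?thesis using assms by simp
qed

lemma rel1_cases:
  assumes "[z] \<in> star_rel X (rel1 P)"
  shows "[z] \<in> star_rel X (rel1 Q) \<or> [z] \<in> star_rel X (rel1 (\<lambda>y. \<not> Q y))"
proof -
  have "sat (star_rel X) (Imp (Rel (rel1 P) [0]) (Disj (Rel (rel1 Q) [0]) (Rel (rel1 (\<lambda>y. \<not> Q y)) [0]))) ((!) [z])"
    by (rule transfer) auto
  then show ?thesis using assms by simp
qed

definition bounded_by :: "'h \<Rightarrow> real \<Rightarrow> real \<Rightarrow> bool" where
  "bounded_by z l h \<longleftrightarrow> [z] \<in> star_rel X (rel1 (\<lambda>y. l \<le> y \<and> y \<le> h))"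

text \<open>The supremum \<open>r\<close> of the standard reals \<open>q\<close> with
  \<open>q \<le> z\<close> is infinitely close to \<open>z\<close>, and no other standard real is,
  so the description in \<open>standard_part\<close> denotes \<open>r\<close>.\<close>

lemma standard_part:
  assumes "bounded_by z l h" "0 < \<epsilon>"
  shows "[z] \<in> star_rel X (rel1 (\<lambda>y. \<bar>y - standard_part X z\<bar> < \<epsilon>))"
proof -
  note z = assms(1)[unfolded bounded_by_def]
  define Q where "Q = {q. [z] \<in> star_rel X (rel1 (\<lambda>y. q \<le> y))}"
  define r where "r = Sup Q"
  have l: "l \<in> Q" unfolding Q_def mem_Collect_eq by (rule rel1_conj[OF z z]) auto
  have h: "q \<le> h" if "q \<in> Q" for q
  proof (rule ccontr)
    assume "\<not> q \<le> h"
    have "[z] \<in> star_rel X (rel1 (\<lambda>y. False))"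
      by (rule rel1_conj[OF z that[unfolded Q_def mem_Collect_eq]]) (use \<open>\<not> q \<le> h\<close> in auto)
    then show False by (rule rel1_False) simp
  qed
  then have bdd: "bdd_above Q" by (meson bdd_above.I)
  have r: "[z] \<in> star_rel X (rel1 (\<lambda>y. \<bar>y - r\<bar> < \<delta>))" if "0 < \<delta>" for \<delta>
  proof -
    have "r + \<delta> / 2 \<notin> Q" using cSup_upper[OF _ bdd, of "r + \<delta> / 2"] that by (auto simp: r_def)
    then have up: "[z] \<in> star_rel X (rel1 (\<lambda>y. \<not> r + \<delta> / 2 \<le> y))"
      using rel1_cases[OF z, of "\<lambda>y. r + \<delta> / 2 \<le> y"] unfolding Q_def by simp
    have "r - \<delta> < Sup Q" using that by (simp add: r_def)
    then obtain q where "q \<in> Q" "r - \<delta> < q"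
      using l by (metis less_cSupE empty_iff)
    then have low: "[z] \<in> star_rel X (rel1 (\<lambda>y. q \<le> y))" unfolding Q_def by simp
    show ?thesis by (rule rel1_conj[OF up low]) (use \<open>r - \<delta> < q\<close> that in auto)
  qed
  have unique: "r' = r" if r': "\<And>\<delta>. 0 < \<delta> \<Longrightarrow> [z] \<in> star_rel X (rel1 (\<lambda>y. \<bar>y - r'\<bar> < \<delta>))" for r'
  proof (rule ccontr)
    assume "r' \<noteq> r"
    then have d: "0 < \<bar>r' - r\<bar> / 2" by simp
    have "[z] \<in> star_rel X (rel1 (\<lambda>y. False))"
      by (rule rel1_conj[OF r[OF d] r'[OF d]]) (simp add: abs_if split: if_splits)
    then show False by (rule rel1_False) simp
  qed
  have "standard_part X z = r"
    unfolding standard_part_def by (rule the_equality) (use r unique in auto)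
  then show ?thesis using r assms(2) by simp
qed

lemma standard_part_le:
  assumes "bounded_by z l h" "[z] \<in> star_rel X (rel1 (\<lambda>y. y \<le> q))"
  shows "standard_part X z \<le> q"
proof (rule ccontr)
  assume "\<not> ?thesis"
  then have d: "0 < standard_part X z - q" by simp
  have "[z] \<in> star_rel X (rel1 (\<lambda>y. False))"
    by (rule rel1_conj[OF standard_part[OF assms(1) d] assms(2)]) auto
  then show False by (rule rel1_False) simp
qed

lemma standard_part_ge:
  assumes "bounded_by z l h" "[z] \<in> star_rel X (rel1 (\<lambda>y. q \<le> y))"
  shows "q \<le> standard_part X z"
proof (rule ccontr)
  assume "\<not> ?thesis"
  then have d: "0 < q - standard_part X z" by simp
  have "[z] \<in> star_rel X (rel1 (\<lambda>y. False))"
    by (rule rel1_conj[OF standard_part[OF assms(1) d] assms(2)]) auto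
  then show False by (rule rel1_False) simp
qed

text \<open>Strictness leaves a standard gap that absorbs the infinitesimal difference; with
  equality, \<open>z\<close> might exceed \<open>q\<close>.\<close>

lemma standard_part_lessD:
  assumes "bounded_by z l h" "standard_part X z < q"
  shows "[z] \<in> star_rel X (rel1 (\<lambda>y. y \<le> q))"
proof -
  have d: "0 < q - standard_part X z" using assms(2) by simp
  show ?thesis
    by (rule rel1_conj[OF standard_part[OF assms(1) d] standard_part[OF assms(1) d]]) auto
qed

lemma standard_part_mono:
  assumes "bounded_by z l h" "bounded_by w l' h'"
    and le: "\<And>\<epsilon>. 0 < \<epsilon> \<Longrightarrow> [z, w] \<in> star_rel X (rel2 (\<lambda>z w. z \<le> w + \<epsilon>))"
  shows "standard_part X z \<le> standard_part X w"
proof (rule ccontr)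
  let ?z = "standard_part X z" and ?w = "standard_part X w"
  \<comment> \<open>A third of the supposed gap: one \<open>d\<close> for each standard part and one
    for the slack in the hypothesis.\<close>
  define d where "d = (?z - ?w) / 3"
  assume "\<not> ?thesis"
  then have d: "0 < d" by (simp add: d_def)
  have "sat (star_rel X) (Neg (Conj (Rel (rel1 (\<lambda>y. \<bar>y - ?z\<bar> < d)) [0]) (Conj (Rel (rel1 (\<lambda>y. \<bar>y - ?w\<bar> < d)) [1])
      (Rel (rel2 (\<lambda>z w. z \<le> w + d)) [0, 1])))) ((!) [z, w])"
  proof (rule transfer, clarsimp)
    fix a b assume "\<bar>a - ?z\<bar> < d" "\<bar>b - ?w\<bar> < d" "a \<le> b + d"
    moreover have "?z - ?w = 3 * d" by (simp add: d_def)
    ultimately show False by linarith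
  qed
  then show False
    using standard_part[OF assms(1) d] standard_part[OF assms(2) d] le[OF d] by simp
qed

abbreviation "mem \<equiv> {[real_in X a, set_in X A] | a A. a \<in> A}"
abbreviation "sub \<equiv> {[set_in X A, real_in X n] | A n. A \<subseteq> natle n}"
abbreviation "below \<equiv> rel2 (\<lambda>a n. a \<in> natle n)"
abbreviation "lsum \<equiv> {[set_in X A, real_in X n, real_in X (\<Sum>a\<in>A. 1 / (a * ln n))] | A n. finite A}"
abbreviation "reflection \<equiv> {[set_in X A, real_in X n, set_in X A'] | A n A'. reflected n A A'}"

end

section \<open>Internal subsets of the hyperfinite interval\<close>

locale hyperfinite_interval = nonstandard X for X :: "('u, 'h) extension" +
  fixes N :: 'h
  assumes N: "infinite_hypnat X N"
begin

abbreviation "S \<equiv> hinterval X (hreal X 1) N"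
abbreviation "I \<equiv> internal_subsets X S"

lemma N_hypnat: "N \<in> hypnat X"
  using N by (simp add: infinite_hypnat_def)

lemma N_nats: "[N] \<in> star_rel X nats"
  using N_hypnat by (simp add: hypnat_def)

lemma N_infinite: "[N] \<in> star_rel X (rel1 (\<lambda>x. r \<le> x))"
proof -
  obtain n :: nat where n: "r \<le> real n" using real_arch_simple by blast
  have "sat (star_rel X) (Imp (Conj (Rel {[real_in X (real n)]} [0]) (Rel leq [0,1]))
      (Rel (rel1 (\<lambda>x. r \<le> x)) [1])) ((!) [hreal X (real n), N])"
    by (rule transfer) (use n in auto)
  then show ?thesis
    using N star_singleton[of "real_in X (real n)"]
    by (simp add: infinite_hypnat_def hle_def hreal_def)
qed

lemma interval_iff: "x \<in> S \<longleftrightarrow> x \<in> hypnat X \<and> hle X x N"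
proof -
  have "sat (star_rel X) (Imp (Conj (Rel {[real_in X 1]} [0]) (Rel nats [1])) (Rel leq [0,1])) ((!) [hreal X 1, x])"
    by (rule transfer) auto
  then have "hle X (hreal X 1) x" if "x \<in> hypnat X"
    using that star_singleton[of "real_in X 1"] by (simp add: hypnat_def hle_def hreal_def)
  then show ?thesis by (auto simp: hinterval_def)
qed

lemma interval_iff_below: "x \<in> S \<longleftrightarrow> [x, N] \<in> star_rel X below"
proof -
  have "sat (star_rel X) (Imp (Rel nats [1]) (Iff (Rel below [0,1]) (Conj (Rel nats [0]) (Rel leq [0,1])))) ((!) [x, N])"
    by (rule transfer) (auto simp: natle_def)
  then show ?thesis using N_nats by (simp add: interval_iff hypnat_def hle_def)
qed

text \<open>The inclusion in \<open>S\<close> becomes a single extended relation, so that internal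
  sets can occur in formulas to be transferred.\<close>

lemma internal_iff: "c \<in> I \<longleftrightarrow> [c, N] \<in> star_rel X sub"
proof -
  have "sat (star_rel X) (Imp (Rel nats [1]) (Iff (Rel sub [0,1]) (Conj (Rel {[set_in X A] | A. True} [0])
      (Forall 2 (Imp (Rel mem [2,0]) (Rel below [2,1])))))) ((!) [c, N])"
    by (rule transfer) (clarsimp, fastforce)
  then show ?thesis
    using N_nats by (simp add: internal_subsets_def elems_def subset_iff interval_iff_below)
qed

text \<open>Set operations are transferred from standard subsets of \<open>natle n\<close>; the
  quantifier over members turns the result into an equality of \<open>elems\<close>. Unions and the
  empty set are treated alike.\<close>

lemma internal_compl:
  assumes "c \<in> I"
  shows "\<exists>d\<in>I. elems X d = S - elems X c"
proof -
  have "sat (star_rel X) (Imp (Rel sub [0,1]) (Ex 2 (Conj (Rel sub [2,1])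
      (Forall 3 (Iff (Rel mem [3,2]) (Conj (Rel below [3,1]) (Neg (Rel mem [3,0])))))))) ((!) [c, N])"
  proof (rule transfer, clarsimp)
    fix A n assume "A \<subseteq> natle n"
    show "\<exists>x. (\<exists>A. x = set_in X A \<and> A \<subseteq> natle n) \<and>
      (\<forall>xa. (\<exists>a. xa = real_in X a \<and> (\<exists>A. x = set_in X A \<and> a \<in> A)) =
        ((\<exists>a. xa = real_in X a \<and> a \<in> natle n) \<and> (\<forall>a. xa = real_in X a \<longrightarrow> a \<notin> A)))"
      by (rule exI[of _ "set_in X (natle n - A)"]) auto
  qed
  then obtain d where "d \<in> I" "\<And>x. [x, d] \<in> star_rel X mem \<longleftrightarrow> x \<in> S \<and> [x, c] \<notin> star_rel X mem"
    using assms by (auto simp: internal_iff interval_iff_below)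
  then show ?thesis by (intro bexI[of _ d]) (auto simp: elems_def)
qed

lemma internal_Un:
  assumes "c \<in> I" "d \<in> I"
  shows "\<exists>e\<in>I. elems X e = elems X c \<union> elems X d"
proof -
  have "sat (star_rel X) (Imp (Conj (Rel sub [0,2]) (Rel sub [1,2])) (Ex 3 (Conj (Rel sub [3,2])
      (Forall 4 (Iff (Rel mem [4,3]) (Disj (Rel mem [4,0]) (Rel mem [4,1]))))))) ((!) [c, d, N])"
  proof (rule transfer, clarsimp)
    fix A B n assume "A \<subseteq> natle n" "B \<subseteq> natle n"
    then show "\<exists>x. (\<exists>A. x = set_in X A \<and> A \<subseteq> natle n) \<and>
      (\<forall>xa. (\<exists>a. xa = real_in X a \<and> (\<exists>A. x = set_in X A \<and> a \<in> A)) =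
        ((\<exists>a. xa = real_in X a \<and> a \<in> A) \<or> (\<exists>a. xa = real_in X a \<and> a \<in> B)))"
      by (intro exI[of _ "set_in X (A \<union> B)"]) auto
  qed
  then obtain e where "e \<in> I" "\<And>x. [x, e] \<in> star_rel X mem \<longleftrightarrow> [x, c] \<in> star_rel X mem \<or> [x, d] \<in> star_rel X mem"
    using assms by (auto simp: internal_iff)
  then show ?thesis by (intro bexI[of _ e]) (auto simp: elems_def)
qed

lemma internal_empty: "\<exists>c\<in>I. elems X c = {}"
proof -
  have "sat (star_rel X) (Imp (Rel nats [0]) (Ex 1 (Conj (Rel sub [1,0])
      (Forall 2 (Neg (Rel mem [2,1])))))) ((!) [N])"
  proof (rule transfer, clarsimp)
    fix n :: nat
    show "\<exists>x. (\<exists>A. x = set_in X A \<and> A \<subseteq> natle (real n)) \<and> (\<forall>a A. x = set_in X A \<longrightarrow> a \<notin> A)"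
      by (intro exI[of _ "set_in X {}"]) auto
  qed
  then show ?thesis using N_nats by (auto simp: internal_iff elems_def)
qed

lemma algebra_internal: "algebra S (elems X ` I)"
  unfolding algebra_iff_Un
proof (intro conjI ballI)
  show "elems X ` I \<subseteq> Pow S" by (auto simp: internal_subsets_def)
  show "{} \<in> elems X ` I" using internal_empty by force
  show "S - A \<in> elems X ` I" if A: "A \<in> elems X ` I" for A
  proof -
    obtain c where "c \<in> I" "A = elems X c" using A by (rule imageE)
    then show ?thesis using internal_compl[of c] by (simp add: image_iff eq_commute)
  qed
  show "A \<union> B \<in> elems X ` I" if A: "A \<in> elems X ` I" and B: "B \<in> elems X ` I" for A B
  proof -
    obtain c where "c \<in> I" "A = elems X c" using A by (rule imageE)
    moreover obtain d where "d \<in> I" "B = elems X d" using B by (rule imageE)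
    ultimately show ?thesis using internal_Un[of c d] by (simp add: image_iff eq_commute)
  qed
qed

lemma log_sum:
  assumes "c \<in> I"
  shows "[c, N, log_sum X N c] \<in> star_rel X lsum"
proof -
  have "sat (star_rel X) (Imp (Rel sub [0,1]) (Ex 2 (Rel lsum [0,1,2]))) ((!) [c, N])"
    by (rule transfer) (auto intro: finite_subset[OF _ finite_natle])
  then obtain z where z: "[c, N, z] \<in> star_rel X lsum" using assms by (auto simp: internal_iff)
  have "sat (star_rel X) (Imp (Conj (Rel lsum [0,1,2]) (Rel lsum [0,1,3])) (Eq 2 3)) ((!) [c, N, w, z])" for w
    by (rule transfer) auto
  then have "w = z" if "[c, N, w] \<in> star_rel X lsum" for w using z that by simp
  with z have "log_sum X N c = z" unfolding log_sum_def by blast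
  with z show ?thesis by simp
qed

lemma log_sum_bounded:
  assumes "c \<in> I"
  shows "bounded_by (log_sum X N c) 0 2"
proof -
  have "sat (star_rel X) (Imp (Conj (Rel nats [1]) (Conj (Rel (rel1 (\<lambda>x. 3 \<le> x)) [1]) (Conj (Rel sub [0,1])
      (Rel lsum [0,1,2])))) (Rel (rel1 (\<lambda>y. 0 \<le> y \<and> y \<le> 2)) [2])) ((!) [c, N, log_sum X N c])"
    by (rule transfer) (use harmonic_log_sum_bounds in auto)
  then show ?thesis
    using assms N_nats N_infinite[of 3] log_sum[OF assms] by (simp add: internal_iff bounded_by_def)
qed

text \<open>The finite reflection transfers to an internal set \<open>d\<close>, and its bounded
  error becomes infinitesimal after division by \<open>ln N\<close>, hence vanishes in the standard
  part.\<close>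

lemma internal_reflection:
  assumes "c \<in> I"
  shows "\<exists>d\<in>I. (\<forall>x\<in>elems X d. \<exists>u\<in>elems X c. x = hquot X N u \<or> u = hquot X N x) \<and>
    standard_part X (log_sum X N c) \<le> standard_part X (log_sum X N d)"
proof -
  have "sat (star_rel X) (Imp (Conj (Rel nats [1]) (Rel sub [0,1])) (Ex 2 (Rel reflection [0,1,2]))) ((!) [c, N])"
    by (rule transfer) (clarsimp, rule ex_reflected, auto)
  then obtain d where d: "[c, N, d] \<in> star_rel X reflection"
    using assms N_nats by (auto simp: internal_iff)
  have "sat (star_rel X) (Imp (Rel reflection [0,1,2]) (Rel sub [2,1])) ((!) [c, N, d])"
    by (rule transfer) (auto simp: reflected_def)
  then have dI: "d \<in> I" using d by (simp add: internal_iff)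
  have "\<exists>u\<in>elems X c. x = hquot X N u \<or> u = hquot X N x" if x: "x \<in> elems X d" for x
  proof -
    have "sat (star_rel X) (Imp (Conj (Rel reflection [0,1,2]) (Rel mem [3,2]))
        (Ex 4 (Conj (Rel mem [4,0]) (Disj (Rel quot_graph [1,4,3]) (Rel quot_graph [1,3,4]))))) ((!) [c, N, d, x])"
    proof (rule transfer, clarsimp)
      fix A n B a assume "reflected n A B" "a \<in> B"
      then obtain u where "u \<in> A" "a = of_int \<lfloor>n / u\<rfloor> \<or> u = of_int \<lfloor>n / a\<rfloor>"
        unfolding reflected_def by blast
      then show "\<exists>x. (\<exists>a. x = real_in X a \<and> a \<in> A) \<and>
          ((\<exists>b. x = real_in X b \<and> a = of_int \<lfloor>n / b\<rfloor>) \<or> x = real_in X (of_int \<lfloor>n / a\<rfloor>))"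
        by (intro exI[of _ "real_in X u"]) auto
    qed
    then obtain u where u: "u \<in> elems X c" "[N, u, x] \<in> star_rel X quot_graph \<or> [N, x, u] \<in> star_rel X quot_graph"
      using d x by (auto simp: elems_def)
    from u(2) have "hquot X N u = x \<or> hquot X N x = u"
      unfolding hquot_def by (elim disj_forward) (rule hfun2_unique, assumption)+
    with u(1) show ?thesis by (intro bexI[of _ u]) auto
  qed
  moreover have "standard_part X (log_sum X N c) \<le> standard_part X (log_sum X N d)"
  proof (rule standard_part_mono[OF log_sum_bounded[OF assms] log_sum_bounded[OF dI]])
    fix \<epsilon> :: real assume "0 < \<epsilon>"
    have "sat (star_rel X) (Imp (Conj (Rel reflection [0,1,2]) (Conj (Rel (rel1 (\<lambda>x. exp (4 / \<epsilon>) \<le> x)) [1])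
        (Conj (Rel lsum [0,1,3]) (Rel lsum [2,1,4])))) (Rel (rel2 (\<lambda>z w. z \<le> w + \<epsilon>)) [3,4]))
        ((!) [c, N, d, log_sum X N c, log_sum X N d])"
      by (rule transfer) (clarsimp, rule reflected_log_sum[OF _ \<open>0 < \<epsilon>\<close>])
    then show "[log_sum X N c, log_sum X N d] \<in> star_rel X (rel2 (\<lambda>z w. z \<le> w + \<epsilon>))"
      using d N_infinite[of "exp (4 / \<epsilon>)"] log_sum[OF assms] log_sum[OF dI] by simp
  qed
  ultimately show ?thesis using dI by blast
qed

end

section \<open>The Loeb measure and the reflection\<close>

locale loeb_space = hyperfinite_interval X N for X :: "('u, 'h) extension" and N +
  assumes saturated: "countably_saturated X"
begin

lemma internal_subset:
  assumes "c \<in> I" "d \<in> I"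
  shows "[c, d] \<in> star_rel X {[set_in X A, set_in X B] | A B. A \<subseteq> B} \<longleftrightarrow> elems X c \<subseteq> elems X d"
proof -
  let ?sub = "{[set_in X A, set_in X B] | A B. A \<subseteq> B}"
  have "sat (star_rel X) (Imp (Conj (Rel sub [0,2]) (Rel sub [1,2]))
      (Iff (Rel ?sub [0,1]) (Forall 3 (Imp (Rel mem [3,0]) (Rel mem [3,1]))))) ((!) [c, d, N])"
  proof (rule transfer, unfold sat_connectives sat.simps, intro impI, elim conjE)
    fix e :: "nat \<Rightarrow> 'u" assume "map e [0,2] \<in> sub" "map e [1,2] \<in> sub"
    then obtain A B where e: "e 0 = set_in X A" "e 1 = set_in X B" by auto
    have "map (e(3 := x)) [3,0] \<in> mem \<longleftrightarrow> (\<exists>a\<in>A. x = real_in X a)" 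
      "map (e(3 := x)) [3,1] \<in> mem \<longleftrightarrow> (\<exists>a\<in>B. x = real_in X a)" for x
      using e by auto
    moreover have "map e [0,1] \<in> ?sub \<longleftrightarrow> A \<subseteq> B" using e by auto
    ultimately show "map e [0,1] \<in> ?sub \<longleftrightarrow> (\<forall>x. map (e(3 := x)) [3,0] \<in> mem \<longrightarrow> map (e(3 := x)) [3,1] \<in> mem)"
      by (simp only:) (auto simp: subset_iff)
  qed
  then show ?thesis using assms by (simp add: internal_iff elems_def subset_iff)
qed

text \<open>Containing \<open>c n\<close> with logarithmic sum at most \<open>q\<close> is an
  internal condition on \<open>d\<close>, and by monotonicity \<open>c n\<close> itself meets the
  conditions with indices up to \<open>n\<close>. Saturation gives a common solution.\<close>

lemma internal_upper_bound:
  assumes c: "\<And>n::nat. c n \<in> I"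
    and mono: "\<And>i n. i \<le> n \<Longrightarrow> elems X (c i) \<subseteq> elems X (c n)"
    and less: "\<And>n. standard_part X (log_sum X N (c n)) < q"
  shows "\<exists>d\<in>I. (\<forall>n. elems X (c n) \<subseteq> elems X d) \<and> standard_part X (log_sum X N d) \<le> q"
proof -
  \<comment> \<open>The clause with \<open>natle\<close> places the common solution in
    \<open>I\<close>; the sum is bounded inside the relation, so the bound passes to the
    solution.\<close>
  let ?R = "{[set_in X D, set_in X A, real_in X n] | D A n.
    A \<subseteq> D \<and> D \<subseteq> natle n \<and> (\<Sum>a\<in>D. 1 / (a * ln n)) \<le> q}"
  let ?sub = "{[set_in X A, set_in X B] | A B. A \<subseteq> B}"
  let ?F = "\<lambda>n. {d. [d, c n, N] \<in> star_rel X ?R}"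
  have "c n \<in> ?F i" if "i \<le> n" for i n
  proof -
    have "sat (star_rel X) (Imp (Conj (Rel sub [0,2]) (Conj (Rel ?sub [1,0])
        (Conj (Rel lsum [0,2,3]) (Rel (rel1 (\<lambda>y. y \<le> q)) [3])))) (Rel ?R [0,1,2])) ((!) [c n, c i, N, log_sum X N (c n)])"
    proof (rule transfer, unfold sat_connectives sat.simps, intro impI, elim conjE)
      fix e :: "nat \<Rightarrow> 'u" assume "map e [0,2] \<in> sub" "map e [1,0] \<in> ?sub"
      then obtain D A x where e: "e 0 = set_in X D" "e 1 = set_in X A" "e 2 = real_in X x" and DA: "A \<subseteq> D" "D \<subseteq> natle x"
        by auto
      assume "map e [0,2,3] \<in> lsum" "map e [3] \<in> rel1 (\<lambda>y. y \<le> q)"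
      then have "(\<Sum>a\<in>D. 1 / (a * ln x)) \<le> q" using e by auto
      with DA show "map e [0,1,2] \<in> ?R" using e by auto
    qed
    moreover have "[log_sum X N (c n)] \<in> star_rel X (rel1 (\<lambda>y. y \<le> q))"
      using standard_part_lessD[OF log_sum_bounded[OF c] less] .
    moreover have "[c i, c n] \<in> star_rel X ?sub"
      using mono[OF that] c internal_subset by blast
    ultimately show ?thesis
      using c[of n] log_sum[OF c[of n]] by (simp add: internal_iff)
  qed
  then have "c n \<in> (\<Inter>i\<le>n. ?F i)" for n by blast
  then have "\<forall>n. (\<Inter>i\<le>n. ?F i) \<noteq> {}" by blast
  moreover have "\<forall>n. internal X (?F n)" unfolding internal_def by blast
  ultimately have "(\<Inter>i. ?F i) \<noteq> {}"
    using saturated unfolding countably_saturated_def by meson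
  then obtain d where d: "\<And>i. [d, c i, N] \<in> star_rel X ?R" by blast
  have *: "sat (star_rel X) (Imp (Rel ?R [0,1,2]) (Conj (Rel sub [0,2]) (Rel ?sub [1,0]))) ((!) [d, c i, N])" for i
    by (rule transfer) auto
  have dI: "d \<in> I" using *[of 0] d[of 0] by (simp add: internal_iff)
  have "elems X (c i) \<subseteq> elems X d" for i
    using *[of i] d[of i] internal_subset[OF c dI, of i] by simp
  moreover have "sat (star_rel X) (Imp (Conj (Rel ?R [0,1,2]) (Rel lsum [0,2,3])) (Rel (rel1 (\<lambda>y. y \<le> q)) [3]))
      ((!) [d, c 0, N, log_sum X N d])"
    by (rule transfer) auto
  then have "standard_part X (log_sum X N d) \<le> q"
    using d[of 0] log_sum[OF dI] by (intro standard_part_le[OF log_sum_bounded[OF dI]]) simp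
  ultimately show ?thesis using dI by blast
qed

definition M :: "'h measure" where
  "M = extend_measure S I (elems X) (\<lambda>c. ennreal (standard_part X (log_sum X N c)))"

lemma loeb_eq: "loeb X N = completion M"
  by (simp add: loeb_def M_def Let_def)

lemma elems_subset: "c \<in> I \<Longrightarrow> elems X c \<subseteq> S"
  by (auto simp: internal_subsets_def)

lemma space_M [simp]: "space M = S"
  and sets_M: "sets M = sigma_sets S (elems X ` I)"
  using elems_subset unfolding M_def
  by (auto simp: space_extend_measure sets_extend_measure image_subset_iff)

text \<open>
  \<open>extend_measure\<close> silently returns the zero measure if the set function has no extension.
  Both alternatives suffice below, so the existence of the Loeb extension need not be proved.
\<close>

lemma emeasure_M_cases:
  "(\<forall>A. emeasure M A = 0) \<or> (\<forall>c\<in>I. emeasure M (elems X c) = ennreal (standard_part X (log_sum X N c)))"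
proof (cases "\<exists>\<mu>'. (\<forall>c\<in>I. \<mu>' (elems X c) = ennreal (standard_part X (log_sum X N c))) \<and>
    measure_space S (sigma_sets S (elems X ` I)) \<mu>'")
  case True
  then obtain \<mu>' where \<mu>': "\<And>c. c \<in> I \<Longrightarrow> \<mu>' (elems X c) = ennreal (standard_part X (log_sum X N c))"
    "measure_space S (sigma_sets S (elems X ` I)) \<mu>'" by blast
  have "emeasure M (elems X c) = ennreal (standard_part X (log_sum X N c))" if "c \<in> I" for c
  proof (rule emeasure_extend_measure[OF M_def \<mu>'(1)])
    show "elems X ` I \<subseteq> Pow S" using elems_subset by auto
    show "positive (sets M) \<mu>'" "countably_additive (sets M) \<mu>'"
      using \<mu>'(2) by (auto simp: measure_space_def sets_M)
  qed (use that in auto)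
  then show ?thesis by blast
next
  case False
  then have "M = sigma S (elems X ` I)"
    unfolding M_def extend_measure_def by (intro if_not_P) blast
  then show ?thesis by (simp add: emeasure_sigma)
qed

lemma standard_part_log_sum_nonneg: "c \<in> I \<Longrightarrow> 0 \<le> standard_part X (log_sum X N c)"
proof -
  assume c: "c \<in> I"
  note b = log_sum_bounded[OF c]
  show ?thesis
    by (rule standard_part_ge[OF b]) (rule rel1_conj[OF b[unfolded bounded_by_def] b[unfolded bounded_by_def]], simp)
qed

lemma measure_M_cases:
  "(\<forall>A. measure M A = 0) \<or> (\<forall>c\<in>I. measure M (elems X c) = standard_part X (log_sum X N c))"
  using emeasure_M_cases standard_part_log_sum_nonneg by (auto simp: measure_def)

lemma ex_elems_interval: "\<exists>c\<in>I. elems X c = S"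
  using internal_empty internal_compl by (metis Diff_empty)

lemma finite_measure_M: "finite_measure M"
  using emeasure_M_cases ex_elems_interval
  by (intro finite_measureI) (metis ennreal_neq_top infinity_ennreal_def space_M ennreal_zero_neq_top)

text \<open>If \<open>M\<close> vanishes, the whole interval is an outer set. Otherwise the bound
  \<open>q\<close> is the measure of the union plus \<open>\<epsilon>\<close>, which gives the
  strict inequality required by \<open>internal_upper_bound\<close>.\<close>

sublocale regular_finite_measure M "elems X ` I"
proof (intro regular_finite_measure.intro regular_finite_measure_axioms.intro finite_measure_M)
  show "algebra (space M) (elems X ` I)" using algebra_internal by simp
  show "sets M = sigma_sets (space M) (elems X ` I)" by (simp add: sets_M)
next
  fix F :: "nat \<Rightarrow> 'h set" and \<epsilon> :: real
  assume F: "range F \<subseteq> elems X ` I" "incseq F" and "0 < \<epsilon>"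
  have "\<forall>n. \<exists>c. c \<in> I \<and> F n = elems X c" using F(1) by blast
  then obtain c where c: "\<And>n. c n \<in> I" "\<And>n. F n = elems X (c n)"
    unfolding choice_iff by blast
  have sets: "F n \<in> sets M" for n unfolding sets_M using F(1) by (intro sigma_sets.Basic) blast
  consider "\<forall>A. measure M A = 0" | "\<forall>c\<in>I. measure M (elems X c) = standard_part X (log_sum X N c)"
    using measure_M_cases by blast
  then show "\<exists>D\<in>elems X ` I. \<Union> (range F) \<subseteq> D \<and> measure M D \<le> measure M (\<Union> (range F)) + \<epsilon>"
  proof cases
    case 1
    obtain s where "s \<in> I" "elems X s = S" using ex_elems_interval by blast
    moreover have "\<Union> (range F) \<subseteq> S" using elems_subset[OF c(1)] unfolding c(2) by blast
    ultimately show ?thesis using 1 \<open>0 < \<epsilon>\<close> by (intro bexI[of _ "elems X s"]) auto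
  next
    case 2
    have "standard_part X (log_sum X N (c n)) < measure M (\<Union> (range F)) + \<epsilon>" for n
    proof -
      have "standard_part X (log_sum X N (c n)) = measure M (F n)" using 2 c by simp
      also have "\<dots> \<le> measure M (\<Union> (range F))"
        by (rule finite_measure.finite_measure_mono[OF finite_measure_M]) (use sets in auto)
      finally show ?thesis using \<open>0 < \<epsilon>\<close> by simp
    qed
    then obtain d where "d \<in> I" "\<And>n. elems X (c n) \<subseteq> elems X d"
      "standard_part X (log_sum X N d) \<le> measure M (\<Union> (range F)) + \<epsilon>"
      using internal_upper_bound[of c "measure M (\<Union> (range F)) + \<epsilon>"] c F(2)
      by (auto simp: incseq_def)
    then show ?thesis using 2 c by (intro bexI[of _ "elems X d"]) auto
  qed
qed

text \<open>The inequality is trivial if \<open>M\<close> vanishes; otherwise measures of internal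
  sets are the standard parts just compared.\<close>

lemma measure_reflection:
  assumes "c \<in> I"
  shows "\<exists>d\<in>I. (\<forall>x\<in>elems X d. \<exists>u\<in>elems X c. x = hquot X N u \<or> u = hquot X N x) \<and>
    measure M (elems X c) \<le> measure M (elems X d)"
  using internal_reflection[OF assms] measure_M_cases assms by fastforce

lemma hquot_interval: "u \<in> S \<Longrightarrow> hquot X N u \<in> S"
  using hquot_hypnat N_hypnat by (simp add: interval_iff)

end

section \<open>The reflection on the space of cut classes\<close>

locale loeb_cut = cut X V + loeb_space X N for X :: "('u, 'h) extension" and V N
begin

abbreviation "\<phi> \<equiv> cut_class X V"
abbreviation "\<sigma> \<equiv> hquot X N"
abbreviation "H \<equiv> cut_space X N V"

lemma cut_class_eq: "u \<in> S \<Longrightarrow> v \<in> S \<Longrightarrow> \<phi> u = \<phi> v \<longleftrightarrow> cut_equiv X V u v"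
  by (simp add: cut_class_eq_iff interval_iff)

lemma cut_class_quot: "u \<in> S \<Longrightarrow> v \<in> S \<Longrightarrow> \<phi> u = \<phi> v \<Longrightarrow> \<phi> (\<sigma> u) = \<phi> (\<sigma> v)"
  using cut_class_eq hquot_interval cut_equiv_hquot[OF N_hypnat] by (simp add: interval_iff)

lemma cut_class_quot_quot: "u \<in> S \<Longrightarrow> \<phi> (\<sigma> (\<sigma> u)) = \<phi> u"
  using cut_class_eq hquot_interval cut_equiv_hquot_hquot[OF N_hypnat] by (simp add: interval_iff)

text \<open>Whichever of \<open>x = \<sigma> u\<close> and \<open>u = \<sigma> x\<close> holds,
  \<open>\<sigma> x\<close> and \<open>u\<close> have the same class, and \<open>B\<close> is a
  union of classes within \<open>S\<close>, so \<open>\<sigma> x\<close> lies in \<open>B\<close>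
  with \<open>u\<close>.\<close>

lemma inner_measure_reflected:
  assumes E: "B = \<phi> -` E \<inter> S" and C: "C \<in> elems X ` I" "C \<subseteq> B"
  shows "\<exists>C'\<in>elems X ` I. C' \<subseteq> {u \<in> S. \<sigma> u \<in> B} \<and> measure M C \<le> measure M C'"
proof -
  obtain c where c: "c \<in> I" "C = elems X c" using C by blast
  obtain d where d: "d \<in> I" "\<And>x. x \<in> elems X d \<Longrightarrow> \<exists>u\<in>elems X c. x = \<sigma> u \<or> u = \<sigma> x"
    "measure M (elems X c) \<le> measure M (elems X d)"
    using measure_reflection[OF c(1)] by auto
  have "x \<in> S \<and> \<sigma> x \<in> B" if x: "x \<in> elems X d" for x
  proof -
    have "x \<in> S" using elems_subset d(1) x by blast
    obtain u where "u \<in> B" "x = \<sigma> u \<or> u = \<sigma> x" using d(2)[OF x] c C by blast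
    then have "\<phi> (\<sigma> x) = \<phi> u" using E cut_class_quot_quot by auto
    with \<open>u \<in> B\<close> \<open>x \<in> S\<close> show ?thesis using E hquot_interval by auto
  qed
  then show ?thesis using d c by (intro bexI[of _ "elems X d"]) auto
qed

lemma loeb_reflected_preimage:
  assumes B: "B = \<phi> -` E \<inter> S" "B \<in> sets (loeb X N)"
  shows "{u \<in> S. \<sigma> u \<in> B} \<in> sets (loeb X N) \<and>
    emeasure (loeb X N) {u \<in> S. \<sigma> u \<in> B} = emeasure (loeb X N) B"
  unfolding loeb_eq
proof (rule completion_inner_measure_preserved)
  show "B \<in> sets (completion M)" using B(2) by (simp add: loeb_eq)
  show "{u \<in> S. \<sigma> u \<in> B} \<subseteq> space M" by auto
  show "\<exists>C'\<in>elems X ` I. C' \<subseteq> {u \<in> S. \<sigma> u \<in> B} \<and> measure M C \<le> measure M C'"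
    if "C \<in> elems X ` I" "C \<subseteq> B" for C
    using inner_measure_reflected[OF B(1) that] .
  \<comment> \<open>As \<open>\<sigma>\<close> maps \<open>S\<close> into itself, preimages commute
    with complements; the complement of \<open>B\<close> is again a union of classes, given by
    \<open>- E\<close>.\<close>
  have eq: "space M - {u \<in> S. \<sigma> u \<in> B} = {u \<in> S. \<sigma> u \<in> S - B}" using hquot_interval by auto
  show "\<exists>C'\<in>elems X ` I. C' \<subseteq> space M - {u \<in> S. \<sigma> u \<in> B} \<and> measure M C \<le> measure M C'"
    if "C \<in> elems X ` I" "C \<subseteq> space M - B" for C
    unfolding eq using that by (intro inner_measure_reflected[of _ "- E"]) (auto simp: B(1))
qed

abbreviation "\<F> \<equiv> {E. E \<subseteq> H \<and> \<phi> -` E \<inter> S \<in> sets (loeb X N)}"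

lemma space_loeb: "space (loeb X N) = S"
  by (simp add: loeb_eq)

lemma cut_class_in: "u \<in> S \<Longrightarrow> \<phi> u \<in> H"
  by (simp add: cut_space_def)

lemma sigma_algebra_cut: "sigma_algebra H \<F>"
  unfolding sigma_algebra_iff2
proof (intro conjI allI ballI impI)
  fix s assume s: "s \<in> \<F>"
  have "\<phi> -` (H - s) \<inter> S = space (loeb X N) - (\<phi> -` s \<inter> S)"
    using cut_class_in by (auto simp: space_loeb)
  also have "\<dots> \<in> sets (loeb X N)" using s by (intro sets.compl_sets) simp
  finally show "H - s \<in> \<F>" by simp
next
  fix A :: "nat \<Rightarrow> 'h set set" assume A: "range A \<subseteq> \<F>"
  have "\<phi> -` (\<Union>i. A i) \<inter> S = (\<Union>i. \<phi> -` A i \<inter> S)" by auto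
  also have "\<dots> \<in> sets (loeb X N)" using A by (intro sets.countable_UN) auto
  finally show "(\<Union>i. A i) \<in> \<F>" using A by auto
qed auto

text \<open>A space built by \<open>measure_of\<close> carries the given set function only if that
  function is a measure. Identifying it with an image measure under \<open>\<phi>\<close> supplies
  this.\<close>

lemma cut_measure_eq: "cut_measure X N V = distr (loeb X N) (sigma H \<F>) \<phi>"
  and sets_cut: "sets (cut_measure X N V) = \<F>"
  and space_cut: "space (cut_measure X N V) = H"
proof -
  have sets: "sets (sigma H \<F>) = \<F>"
    using sigma_algebra.sets_measure_of_eq[OF sigma_algebra_cut] by simp
  have space: "space (sigma H \<F>) = H" by (rule space_measure_of) auto
  show "cut_measure X N V = distr (loeb X N) (sigma H \<F>) \<phi>"
    unfolding distr_def sets space by (simp add: cut_measure_def Let_def space_loeb)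
  then show "sets (cut_measure X N V) = \<F>" "space (cut_measure X N V) = H"
    using sets space by simp_all
qed

lemma emeasure_cut:
  assumes "E \<in> \<F>"
  shows "emeasure (cut_measure X N V) E = emeasure (loeb X N) (\<phi> -` E \<inter> S)"
proof -
  have sets: "sets (sigma H \<F>) = \<F>"
    using sigma_algebra.sets_measure_of_eq[OF sigma_algebra_cut] by simp
  have space: "space (sigma H \<F>) = H" by (rule space_measure_of) auto
  have "\<phi> \<in> measurable (loeb X N) (sigma H \<F>)"
    by (rule measurableI) (auto simp: sets space space_loeb cut_class_in)
  then show ?thesis
    unfolding cut_measure_eq using assms by (subst emeasure_distr) (auto simp: sets space_loeb)
qed

text \<open>Every element of \<open>H\<close> is a class of some \<open>u\<close> in
  \<open>S\<close>, which fixes the values on \<open>H\<close>; extensionality fixes them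
  elsewhere.\<close>

lemma ex1_reflection:
  "\<exists>!\<Upsilon>. \<Upsilon> \<in> H \<rightarrow>\<^sub>E H \<and> (\<forall>u\<in>S. \<Upsilon> (\<phi> u) = \<phi> (\<sigma> u))"
proof (rule ex_ex1I)
  \<comment> \<open>An arbitrary representative of each class; \<open>cut_class_quot\<close> makes
    the resulting value independent of the choice.\<close>
  define r where "r E = (SOME u. u \<in> S \<and> \<phi> u = E)" for E
  have r: "r (\<phi> u) \<in> S \<and> \<phi> (r (\<phi> u)) = \<phi> u" if "u \<in> S" for u
    unfolding r_def by (rule someI[of _ u]) (use that in simp)
  define \<Upsilon> where "\<Upsilon> = restrict (\<lambda>E. \<phi> (\<sigma> (r E))) H"
  have eq: "\<Upsilon> (\<phi> u) = \<phi> (\<sigma> u)" if "u \<in> S" for u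
    using cut_class_quot[of "r (\<phi> u)" u] r[OF that] that cut_class_in[OF that] by (simp add: \<Upsilon>_def)
  have "\<Upsilon> \<in> H \<rightarrow>\<^sub>E H"
  proof (rule PiE_I)
    fix E assume "E \<in> H"
    then obtain u where "u \<in> S" "E = \<phi> u" by (auto simp: cut_space_def)
    then show "\<Upsilon> E \<in> H" using eq hquot_interval cut_class_in by simp
  qed (simp add: \<Upsilon>_def)
  with eq show "\<exists>\<Upsilon>. \<Upsilon> \<in> H \<rightarrow>\<^sub>E H \<and> (\<forall>u\<in>S. \<Upsilon> (\<phi> u) = \<phi> (\<sigma> u))"
    by (intro exI[of _ \<Upsilon>] conjI ballI)
next
  fix f g
  assume f: "f \<in> H \<rightarrow>\<^sub>E H \<and> (\<forall>u\<in>S. f (\<phi> u) = \<phi> (\<sigma> u))"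
    and g: "g \<in> H \<rightarrow>\<^sub>E H \<and> (\<forall>u\<in>S. g (\<phi> u) = \<phi> (\<sigma> u))"
  show "f = g"
  proof (rule PiE_ext)
    show "f \<in> H \<rightarrow>\<^sub>E H" "g \<in> H \<rightarrow>\<^sub>E H" using f g by auto
    fix E assume "E \<in> H"
    then obtain u where "u \<in> S" "E = \<phi> u" by (auto simp: cut_space_def)
    then show "f E = g E" using f g by simp
  qed
qed

context
  fixes \<Upsilon>
  assumes \<Upsilon>: "\<Upsilon> \<in> H \<rightarrow>\<^sub>E H" "\<And>u. u \<in> S \<Longrightarrow> \<Upsilon> (\<phi> u) = \<phi> (\<sigma> u)"
begin

lemma reflection_in: "E \<in> H \<Longrightarrow> \<Upsilon> E \<in> H"
  using \<Upsilon>(1) by auto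

lemma reflection_involution:
  assumes "E \<in> H"
  shows "\<Upsilon> (\<Upsilon> E) = E"
proof -
  obtain u where "u \<in> S" "E = \<phi> u" using assms by (auto simp: cut_space_def)
  then show ?thesis using \<Upsilon>(2) hquot_interval cut_class_quot_quot by simp
qed

lemma reflection_measure_preserving: "measure_preserving_map (cut_measure X N V) \<Upsilon>"
proof -
  have *: "\<Upsilon> -` E \<inter> H \<in> \<F> \<and>
      emeasure (cut_measure X N V) (\<Upsilon> -` E \<inter> H) = emeasure (cut_measure X N V) E" if E: "E \<in> \<F>" for E
  proof -
    \<comment> \<open>Pulled back along \<open>\<phi>\<close>, the preimage under
      \<open>\<Upsilon>\<close> is the preimage under \<open>\<sigma>\<close> of a union of classes,
      to which \<open>loeb_reflected_preimage\<close> applies.\<close>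
    have eq: "\<phi> -` (\<Upsilon> -` E \<inter> H) \<inter> S = {u \<in> S. \<sigma> u \<in> \<phi> -` E \<inter> S}"
      using \<Upsilon>(2) hquot_interval cut_class_in by auto
    have "\<phi> -` E \<inter> S \<in> sets (loeb X N)" using E by simp
    from loeb_reflected_preimage[OF refl this]
    have L: "{u \<in> S. \<sigma> u \<in> \<phi> -` E \<inter> S} \<in> sets (loeb X N)"
      "emeasure (loeb X N) {u \<in> S. \<sigma> u \<in> \<phi> -` E \<inter> S} = emeasure (loeb X N) (\<phi> -` E \<inter> S)"
      by blast+
    have F: "\<Upsilon> -` E \<inter> H \<in> \<F>" unfolding mem_Collect_eq eq using L(1) by blast
    then show ?thesis using L(2) emeasure_cut[OF F] emeasure_cut[OF E] eq by simp
  qed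
  show ?thesis
    unfolding measure_preserving_map_def
  proof (intro conjI ballI measurableI)
    show "\<Upsilon> x \<in> space (cut_measure X N V)" if "x \<in> space (cut_measure X N V)" for x
      using that reflection_in by (simp add: space_cut)
    show "\<Upsilon> -` A \<inter> space (cut_measure X N V) \<in> sets (cut_measure X N V)"
      if "A \<in> sets (cut_measure X N V)" for A
      using that * unfolding sets_cut space_cut by blast
    show "emeasure (cut_measure X N V) (\<Upsilon> -` A \<inter> space (cut_measure X N V)) = emeasure (cut_measure X N V) A"
      if "A \<in> sets (cut_measure X N V)" for A
      using that * unfolding sets_cut space_cut by blast
  qed
qed

lemma reflection_invertible: "invertible_measure_preserving (cut_measure X N V) \<Upsilon>"
  unfolding invertible_measure_preserving_def
  using reflection_measure_preserving reflection_involution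
  by (intro conjI exI[of _ \<Upsilon>] AE_I2) (auto simp: space_cut)

lemma reflection_bij: "bij_betw \<Upsilon> H H"
  by (rule bij_betw_byWitness[of _ \<Upsilon>]) (auto simp: reflection_involution reflection_in)

lemma inv_into_reflection: "x \<in> H \<Longrightarrow> inv_into H \<Upsilon> x = \<Upsilon> x"
  using reflection_bij reflection_involution reflection_in
  by (intro inv_into_f_eq) (auto simp only: bij_betw_def)

end

end

text \<open>Unique existence among extensional maps expresses well-definedness; the second conjunct,
  stated for every map with the defining property, therefore speaks of that one map.\<close>

theorem theorem6p1:
  fixes X :: "('u, 'h) extension" and N :: 'h and V :: "'h set"
  assumes "nonstandard_extension X"
    and "countably_saturated X"
    and "infinite_hypnat X N"
    and "multiplicative_cut X V"
    and "V \<subseteq> hinterval X (hreal X 1) N"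
  shows "(\<exists>!\<Upsilon>. \<Upsilon> \<in> cut_space X N V \<rightarrow>\<^sub>E cut_space X N V \<and>
             (\<forall>u\<in>hinterval X (hreal X 1) N.
                \<Upsilon> (cut_class X V u) = cut_class X V (hquot X N u)))
       \<and> (\<forall>\<Upsilon> \<in> cut_space X N V \<rightarrow>\<^sub>E cut_space X N V.
             (\<forall>u\<in>hinterval X (hreal X 1) N.
                \<Upsilon> (cut_class X V u) = cut_class X V (hquot X N u)) \<longrightarrow>
             invertible_measure_preserving (cut_measure X N V) \<Upsilon> \<and>
             bij_betw \<Upsilon> (cut_space X N V) (cut_space X N V) \<and>
             (\<forall>x\<in>cut_space X N V. inv_into (cut_space X N V) \<Upsilon> x = \<Upsilon> x))"
proof -
  interpret loeb_cut X V N
    by standard (use assms in auto)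
  show ?thesis
    using ex1_reflection
    by (intro conjI ballI impI reflection_invertible reflection_bij inv_into_reflection) auto
qed

end
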